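(* Let $0<d\le n$, $\alpha\in(0,d)$, and $1<p<\frac{d}{\alpha}$. There exists a constant $C=C(\alpha,p,d,n)>0$ such that $$\int_{\mathbb{R}^n}|I_\alpha^\mu f|^p\,d\nu\le C\,\|f\|_{L^{p,1}(\mathbb{R}^n,\mu)}^p$$ for all $f\in L^{p,1}(\mathbb{R}^n,\mu)$ and for all Radon measures $\mu,\nu$ on $\mathbb{R}^n$ which satisfy $$\sup_{Q}\frac{\mu(Q)}{l(Q)^{d}}<\infty\qquad\text{and}\qquad \sup_{\mu(Q)>0}\frac{\nu(Q)}{\mu(Q)^{1-\frac{\alpha p}{d}}}<\infty.$$ Here the Riesz potential $I_\alpha^\mu$ of order $\alpha\in(0,d)$ with respect to $\mu$ is defined by $$I_\alpha^\mu f(x)=\int_{\mathbb{R}^n}\frac{f(y)}{|x-y|^{d-\alpha}}\,d\mu(y),\quad x\in\mathbb{R}^n.$$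
   Context: The suprema are over cubes $Q\subseteq\mathbb{R}^n$ (in the second one, over those with $\mu(Q)>0$), and $l(Q)$ is the side length of $Q$. The Lorentz space $L^{p,1}(\mathbb{R}^n,\mu)$ consists of all $\mu$-measurable $f$ with $\|f\|_{L^{p,1}(\mathbb{R}^n,\mu)}=\int_0^\infty t^{\frac1p-1}f^*_\mu(t)\,dt<\infty$ (which equals $p\int_0^\infty\mu(\{|f|>t\})^{1/p}\,dt$), where $f^*_\mu(t)=\inf\{\lambda>0:\mu(\{|f|>\lambda\})\le t\}$ is the nonincreasing rearrangement of $f$ with respect to $\mu$.
   Formalization: The constant C depends also on finite upper bounds A, B for the two suprema, not only on α, p, d, n; with C independent of them the claim fails, as replacing ν by kν multiplies only the left side by k. *)

theory Defs
  imports "HOL-Analysis.Analysis"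
begin

(* Regularity is not listed: on R^n every Borel measure that is finite on compact sets is
   inner and outer regular. *)
definition radon_measure :: "(real ^ 'n) measure \<Rightarrow> bool" where
  "radon_measure \<mu> \<longleftrightarrow> sets \<mu> = sets borel \<and> (\<forall>K. compact K \<longrightarrow> emeasure \<mu> K < \<infinity>)"

(* Cubes are closed and have sides parallel to the axes.  By monotone limits, open or half-open
   cubes give the same values of the two suprema below. *)
definition cube :: "real ^ 'n \<Rightarrow> real \<Rightarrow> (real ^ 'n) set" where
  "cube a l = cbox a (\<chi> i. a $ i + l)"

definition growth_sup :: "real \<Rightarrow> (real ^ 'n) measure \<Rightarrow> ennreal" where
  "growth_sup d \<mu> = (SUP (a, l) \<in> {(a, l). 0 < l}. emeasure \<mu> (cube a l) / ennreal (l powr d))"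

definition ratio_sup :: "real \<Rightarrow> (real ^ 'n) measure \<Rightarrow> (real ^ 'n) measure \<Rightarrow> ennreal" where
  "ratio_sup s \<mu> \<nu> =
     (SUP (a, l) \<in> {(a, l). 0 < l \<and> 0 < emeasure \<mu> (cube a l)}.
        emeasure \<nu> (cube a l) / ennreal (measure \<mu> (cube a l) powr s))"

(* Measurability with respect to \<mu> means measurability with respect to the completion of \<mu>,
   so all notions involving f are taken over completion \<mu>.
   The infimum is in ennreal, hence \<infinity> when no s qualifies. *)
definition rearrangement :: "'a measure \<Rightarrow> ('a \<Rightarrow> real) \<Rightarrow> real \<Rightarrow> ennreal" where
  "rearrangement \<mu> f t =
     Inf {ennreal s | s. 0 < s \<and>
       emeasure (completion \<mu>) {x \<in> space \<mu>. s < \<bar>f x\<bar>} \<le> ennreal t}"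

definition lorentz_norm :: "real \<Rightarrow> 'a measure \<Rightarrow> ('a \<Rightarrow> real) \<Rightarrow> ennreal" where
  "lorentz_norm p \<mu> f =
     (\<integral>\<^sup>+ t \<in> {0<..}. (ennreal (t powr (1 / p - 1)) * rearrangement \<mu> f t) \<partial>lborel)"

definition lorentz_space :: "real \<Rightarrow> 'a measure \<Rightarrow> ('a \<Rightarrow> real) set" where
  "lorentz_space p \<mu> = {f \<in> borel_measurable (completion \<mu>). lorentz_norm p \<mu> f < \<infinity>}"

(* At y = x the kernel is 0 here instead of \<infinity>.  This is immaterial when growth_sup d \<mu> is finite
   and d > 0, since \<mu> then has no atoms. *)
definition riesz_kernel :: "real \<Rightarrow> real \<Rightarrow> real ^ 'n \<Rightarrow> real ^ 'n \<Rightarrow> real" where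
  "riesz_kernel d \<alpha> x y = 1 / norm (x - y) powr (d - \<alpha>)"

(* The Bochner integral is 0 where the integrand is not integrable; a bound on riesz_potential is
   therefore only meaningful together with riesz_defined almost everywhere. *)
definition riesz_defined ::
  "real \<Rightarrow> real \<Rightarrow> (real ^ 'n) measure \<Rightarrow> (real ^ 'n \<Rightarrow> real) \<Rightarrow> real ^ 'n \<Rightarrow> bool" where
  "riesz_defined d \<alpha> \<mu> f x \<longleftrightarrow> integrable (completion \<mu>) (\<lambda>y. f y * riesz_kernel d \<alpha> x y)"

definition riesz_potential ::
  "real \<Rightarrow> real \<Rightarrow> (real ^ 'n) measure \<Rightarrow> (real ^ 'n \<Rightarrow> real) \<Rightarrow> real ^ 'n \<Rightarrow> real" where
  "riesz_potential d \<alpha> \<mu> f x = (\<integral>y. f y * riesz_kernel d \<alpha> x y \<partial>completion \<mu>)"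

end

theory Submission
  imports Defs "HOL-Library.Nat_Bijection"
begin

text \<open>By convexity of the p-th power it is enough to prove the inequality for f = 1_E; a general f is
  reduced to its dyadic level sets, whose contributions 2^j \<mu>(|f| > 2^j)^(1/p) add up to at most a
  multiple of the Lorentz norm.

  For a set E put e_k(x) = \<mu>(E \<inter> B(x, 2^k)). The potential of 1_E is comparable to the sum S(x) over k
  of v_k(x) = 2^(-(d - \<alpha>)k) e_k(x), and v_k(x) \<le> A 2^(\<alpha>k) by the growth of \<mu>. Fix 1 < a < p. For every
  x some scale k satisfies both S(x) \<le> K 2^(\<alpha>k) and S(x)^p \<le> K' v_k(x)^a 2^(\<alpha>k(p - a)). Summing
  over all k with the first property, writing one factor e_k(x) as an integral over y in E, exchanging the
  integrals and using \<nu>(B(y, 2^k)) \<le> B 2^(k(d - \<alpha>p)) bounds the integral of S^p by that over y in E of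
  the sum of (2^(-kd) e_k(y))^(a - 1) over the scales k with S(x) \<le> K 2^(\<alpha>k) for some x near y. Since
  S(x) dominates every v_m(x), the densities 2^(-md) e_m(y) at such k are at most a multiple of
  2^(-\<alpha>(m - k)) for all m \<ge> k, so that this sum is bounded.\<close>

section \<open>Sums over the integers\<close>

text \<open>Enumerating the integers by \<open>int_decode\<close> gives a series over
  \<open>nat\<close>, for which monotonicity and exchange with integrals are at hand. The terms are
  nonnegative, so the enumeration does not affect the value.\<close>

definition zsum :: "(int \<Rightarrow> ennreal) \<Rightarrow> ennreal" where
  "zsum f = (\<Sum>n. f (int_decode n))"

lemma zsum_mono: "(\<And>k. f k \<le> g k) \<Longrightarrow> zsum f \<le> zsum g"
  unfolding zsum_def by (intro suminf_le) auto

lemma zsum_ge_term: "f k \<le> zsum f"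
proof -
  have "(\<Sum>n\<in>{int_encode k}. f (int_decode n)) \<le> zsum f"
    unfolding zsum_def by (intro sum_le_suminf) auto
  then show ?thesis by simp
qed

lemma zsum_cmult: "zsum (\<lambda>k. c * f k) = c * zsum f"
  unfolding zsum_def by simp

lemma zsum_add: "zsum (\<lambda>k. f k + g k) = zsum f + zsum g"
  unfolding zsum_def by (intro suminf_add[symmetric]) auto

lemma borel_measurable_zsum [measurable (raw)]:
  assumes "\<And>k. f k \<in> borel_measurable M"
  shows "(\<lambda>x. zsum (\<lambda>k. f k x)) \<in> borel_measurable M"
  unfolding zsum_def using assms by measurable

lemma nn_integral_zsum:
  assumes "\<And>k. f k \<in> borel_measurable M"
  shows "(\<integral>\<^sup>+x. zsum (\<lambda>k. f k x) \<partial>M) = zsum (\<lambda>k. \<integral>\<^sup>+x. f k x \<partial>M)"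
  unfolding zsum_def using assms by (intro nn_integral_suminf) auto

lemma nn_integral_zsum_cmult:
  assumes "\<And>k. f k \<in> borel_measurable M"
  shows "(\<integral>\<^sup>+x. zsum (\<lambda>k. c k * f k x) \<partial>M) = zsum (\<lambda>k. c k * (\<integral>\<^sup>+x. f k x \<partial>M))"
  using assms by (simp add: nn_integral_zsum nn_integral_cmult)

lemma zsum_count_space: "zsum f = (\<integral>\<^sup>+k. f k \<partial>count_space UNIV)"
proof -
  have "zsum f = (\<integral>\<^sup>+n. f (int_decode n) \<partial>count_space UNIV)"
    unfolding zsum_def by (simp add: nn_integral_count_space_nat)
  also have "\<dots> = (\<integral>\<^sup>+k. f k \<partial>count_space UNIV)"
    by (rule nn_integral_bij_count_space) (rule bij_int_decode)
  finally show ?thesis .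
qed

text \<open>Read as integrals for counting measure, the two sides differ by the substitution
  \<open>h\<close>. Sums over a half-line of integers thereby become series over
  \<open>nat\<close>.\<close>

lemma zsum_range:
  fixes h :: "nat \<Rightarrow> int"
  assumes "inj h"
  shows "zsum (\<lambda>k. if k \<in> range h then f k else 0) = (\<Sum>n. f (h n))"
proof -
  have "zsum (\<lambda>k. if k \<in> range h then f k else 0) = (\<integral>\<^sup>+k. f k * indicator (range h) k \<partial>count_space UNIV)"
    unfolding zsum_count_space by (intro nn_integral_cong) (auto simp: indicator_def)
  also have "\<dots> = (\<integral>\<^sup>+k. f k \<partial>count_space (range h))"
    by (simp add: nn_integral_count_space_indicator)
  also have "\<dots> = (\<integral>\<^sup>+n. f (h n) \<partial>count_space UNIV)"
    using assms by (intro nn_integral_bij_count_space[symmetric]) (auto simp: bij_betw_def)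
  finally show ?thesis by (simp add: nn_integral_count_space_nat)
qed

section \<open>Geometric series over half-lines of integers\<close>

lemma suminf_ennreal_powr:
  fixes \<beta> :: real
  assumes "\<beta> > 0"
  shows "(\<Sum>n. ennreal (2 powr (- \<beta> * real n))) = ennreal (1 / (1 - 2 powr - \<beta>))"
proof -
  have *: "2 powr (- \<beta> * real n) = (2 powr - \<beta>) ^ n" for n
    by (metis powr_powr powr_realpow powr_gt_zero zero_neq_numeral)
  have "norm (2 powr - \<beta>) < 1"
    using assms by (simp add: powr_less_one)
  from geometric_sums[OF this] show ?thesis
    unfolding * by (intro suminf_ennreal_eq) auto
qed

lemma zsum_geometric_up:
  fixes \<beta> :: real
  assumes "\<beta> > 0"
  shows "zsum (\<lambda>k. if k0 \<le> k then ennreal (2 powr (- \<beta> * (real_of_int k - real_of_int k0))) else 0)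
    = ennreal (1 / (1 - 2 powr - \<beta>))"
proof -
  have r: "range (\<lambda>n. k0 + int n) = {k0..}"
    by (auto simp: image_iff intro: zle_iff_zadd[THEN iffD1])
  have "inj (\<lambda>n. k0 + int n)" by (auto intro: injI)
  from zsum_range[OF this, of "\<lambda>k. ennreal (2 powr (- \<beta> * (real_of_int k - real_of_int k0)))"]
  show ?thesis unfolding r suminf_ennreal_powr[OF assms, symmetric] by simp
qed

lemma zsum_geometric_down:
  fixes \<beta> :: real
  assumes "\<beta> > 0"
  shows "zsum (\<lambda>k. if k \<le> k0 then ennreal (2 powr (\<beta> * (real_of_int k - real_of_int k0))) else 0)
    = ennreal (1 / (1 - 2 powr - \<beta>))"
proof -
  have r: "range (\<lambda>n. k0 - int n) = {..k0}"
  proof -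
    have "k \<in> range (\<lambda>n. k0 - int n)" if "k \<le> k0" for k
      using that by (intro image_eqI[of _ _ "nat (k0 - k)"]) auto
    then show ?thesis by auto
  qed
  have "inj (\<lambda>n. k0 - int n)" by (auto intro: injI)
  from zsum_range[OF this, of "\<lambda>k. ennreal (2 powr (\<beta> * (real_of_int k - real_of_int k0)))"]
  show ?thesis unfolding r suminf_ennreal_powr[OF assms, symmetric] by simp
qed

section \<open>Selection of scales\<close>

text \<open>Used with v k = 2^(-(d - \<alpha>)k) \<mu>(E \<inter> B(x, 2^k)), for which the growth of \<mu> gives
  v k \<le> A 2^(\<alpha>k). The scales with K 2^(\<alpha>k) < S then carry at most a third of the sum, and among the
  remaining ones some v k is not much smaller than S, up to a geometrically decaying factor.\<close>

lemma dominant_scale: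
  fixes \<alpha> A p a :: real
  assumes "\<alpha> > 0" "A > 0" "0 < a" "a < p"
  obtains K K' where "K > 0" "K' > 0"
    "\<And>(v :: int \<Rightarrow> real) S. \<lbrakk>\<And>k. 0 \<le> v k; \<And>k. v k \<le> A * 2 powr (\<alpha> * k); S > 0;
       zsum (\<lambda>k. ennreal (v k)) = ennreal S\<rbrakk> \<Longrightarrow>
       \<exists>k. S \<le> K * 2 powr (\<alpha> * k) \<and> S powr p \<le> K' * (v k powr a * 2 powr (\<alpha> * k * (p - a)))"
proof -
  \<comment> \<open>The exponent satisfies 1 + q = p / a, and \<beta> a = \<alpha>(p - a) is the
    power of 2^k wanted in the conclusion.\<close>
  define q where "q = (p - a) / a"
  define \<beta> where "\<beta> = \<alpha> * q"
  define W where "W = 1 / (1 - 2 powr - \<alpha>)"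
  define W2 where "W2 = 1 / (1 - 2 powr - \<beta>)"
  \<comment> \<open>\<open>W\<close> and \<open>W2\<close> are the sums of the geometric series with
    ratios 2^(-\<alpha>) and 2^(-\<beta>). The factor 3 makes the scales up to \<open>k0\<close>
    below carry at most S / 3.\<close>
  define K where "K = 3 * A * W"
  define K' where "K' = (3 * W2 * K powr q) powr a"
  have q: "q > 0" and \<beta>: "\<beta> > 0" using assms by (auto simp: q_def \<beta>_def)
  have W: "W > 0" "W2 > 0" unfolding W_def W2_def using assms \<beta> by (auto simp: powr_less_one)
  have K: "K > 0" "K' > 0" using assms W by (auto simp: K_def K'_def)
  have *: "\<exists>k. S \<le> K * 2 powr (\<alpha> * k) \<and> S powr p \<le> K' * (v k powr a * 2 powr (\<alpha> * k * (p - a)))"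
    if v: "\<And>k. 0 \<le> v k" "\<And>k. v k \<le> A * 2 powr (\<alpha> * real_of_int k)" and S: "S > 0"
      and sum: "zsum (\<lambda>k. ennreal (v k)) = ennreal S" for v :: "int \<Rightarrow> real" and S
  proof -
    \<comment> \<open>The largest integer with K 2^(\<alpha> k0) \<le> S; every later scale has the
      first of the two properties.\<close>
    define k0 where "k0 = \<lfloor>log 2 (S / K) / \<alpha>\<rfloor>"
    have "\<alpha> * k0 \<le> log 2 (S / K)"
      unfolding k0_def using assms(1) of_int_floor_le[of "log 2 (S / K) / \<alpha>"]
      by (metis mult.commute pos_le_divide_eq)
    then have lo: "K * 2 powr (\<alpha> * k0) \<le> S"
      using K S by (simp add: le_log_iff field_simps)
    have "log 2 (S / K) \<le> \<alpha> * (k0 + 1)"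
      unfolding k0_def using assms(1) real_of_int_floor_add_one_ge[of "log 2 (S / K) / \<alpha>"]
      by (simp add: field_simps)
    then have hi: "S / K \<le> 2 powr (\<alpha> * (k0 + 1))"
      using K S by (simp add: log_le_iff)
    \<comment> \<open>Otherwise the scales up to \<open>k0\<close> and the scales beyond would
      contribute at most S / 3 each, too little for the total S > 0.\<close>
    have "\<exists>k \<ge> k0 + 1. S / (3 * W2) * 2 powr (- \<beta> * (real_of_int k - real_of_int (k0 + 1))) < v k"
    proof (rule ccontr)
      assume "\<not> ?thesis"
      then have small: "v k \<le> S / (3 * W2) * 2 powr (- \<beta> * (real_of_int k - real_of_int (k0 + 1)))"
        if "k \<ge> k0 + 1" for k using that by (meson not_le)
      have "ennreal S \<le> zsum (\<lambda>k. ennreal (A * 2 powr (\<alpha> * k0)) *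
            (if k \<le> k0 then ennreal (2 powr (\<alpha> * (real_of_int k - real_of_int k0))) else 0)
          + ennreal (S / (3 * W2)) *
            (if k0 + 1 \<le> k then ennreal (2 powr (- \<beta> * (real_of_int k - real_of_int (k0 + 1)))) else 0))"
        unfolding sum[symmetric]
      proof (rule zsum_mono)
        fix k
        show "ennreal (v k) \<le> ennreal (A * 2 powr (\<alpha> * k0)) *
            (if k \<le> k0 then ennreal (2 powr (\<alpha> * (real_of_int k - real_of_int k0))) else 0)
          + ennreal (S / (3 * W2)) *
            (if k0 + 1 \<le> k then ennreal (2 powr (- \<beta> * (real_of_int k - real_of_int (k0 + 1)))) else 0)"
        proof (cases "k \<le> k0")
          case True
          have "A * 2 powr (\<alpha> * k) = A * 2 powr (\<alpha> * k0) * 2 powr (\<alpha> * (real_of_int k - real_of_int k0))"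
            by (simp add: powr_add[symmetric] algebra_simps)
          with v(2)[of k] True assms show ?thesis
            by (simp add: ennreal_mult[symmetric])
        next
          case False
          with small[of k] W S show ?thesis by (simp add: ennreal_mult[symmetric])
        qed
      qed
      also have "\<dots> = ennreal (A * 2 powr (\<alpha> * k0)) * ennreal W + ennreal (S / (3 * W2)) * ennreal W2"
        unfolding zsum_add zsum_cmult zsum_geometric_down[OF assms(1)] zsum_geometric_up[OF \<beta>]
        by (simp add: W_def W2_def)
      also have "\<dots> = ennreal (A * 2 powr (\<alpha> * k0) * W + S / 3)"
        using assms W S by (simp add: ennreal_mult[symmetric] ennreal_plus[symmetric] del: ennreal_plus)
      also have "\<dots> < ennreal S"
      proof (rule ennreal_lessI[OF S])
        show "A * 2 powr (\<alpha> * k0) * W + S / 3 < S"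
          using lo S unfolding K_def by (simp add: algebra_simps)
      qed
      finally show False by simp
    qed
    then obtain k where k: "k \<ge> k0 + 1"
      and big: "S / (3 * W2) * 2 powr (- \<beta> * (real_of_int k - real_of_int (k0 + 1))) < v k" by blast
    have "S \<le> K * 2 powr (\<alpha> * k)"
    proof -
      have "S \<le> K * 2 powr (\<alpha> * (k0 + 1))" using hi K by (simp add: field_simps)
      also have "\<dots> \<le> K * 2 powr (\<alpha> * k)"
        using k assms K by (intro mult_left_mono) auto
      finally show ?thesis .
    qed
    moreover have "S powr p \<le> K' * (v k powr a * 2 powr (\<alpha> * k * (p - a)))"
    proof -
      \<comment> \<open>Multiplying this bound on S^q by the bound on S contained in
        \<open>big\<close> cancels \<open>k0\<close> and leaves S^(p / a) against v_k 2^(\<beta> k);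
        the a-th power is the claim.\<close>
      have "(S / K) powr q \<le> (2 powr (\<alpha> * (k0 + 1))) powr q"
        using hi q S K by (intro powr_mono2) auto
      also have "\<dots> = 2 powr (\<beta> * (k0 + 1))" by (simp add: powr_powr \<beta>_def algebra_simps)
      finally have 1: "S powr q \<le> K powr q * 2 powr (\<beta> * (k0 + 1))"
        using S K by (simp add: powr_divide field_simps)
      have "S < 3 * W2 * v k * 2 powr (\<beta> * (real_of_int k - real_of_int (k0 + 1)))"
      proof -
        define t where "t = \<beta> * (real_of_int k - real_of_int (k0 + 1))"
        have "S / (3 * W2) * 2 powr - t < v k" using big by (simp only: t_def mult_minus_left)
        then show ?thesis unfolding t_def[symmetric] using W by (simp add: powr_minus field_simps)
      qed
      then have "S * S powr q \<le> (3 * W2 * v k * 2 powr (\<beta> * (real_of_int k - real_of_int (k0 + 1))))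
          * (K powr q * 2 powr (\<beta> * (k0 + 1)))"
        using 1 S v(1)[of k] W by (intro mult_mono) auto
      also have "\<dots> = 3 * W2 * K powr q * v k * (2 powr (\<beta> * (real_of_int k - real_of_int (k0 + 1))) * 2 powr (\<beta> * (k0 + 1)))"
        by (simp add: mult_ac)
      also have "2 powr (\<beta> * (real_of_int k - real_of_int (k0 + 1))) * 2 powr (\<beta> * (k0 + 1)) = 2 powr (\<beta> * k)"
        unfolding powr_add[symmetric] by (simp add: algebra_simps)
      also have "S * S powr q = S powr (p / a)"
      proof -
        have "p / a = 1 + q" using assms by (simp add: q_def field_simps)
        then show ?thesis using S by (simp add: powr_add)
      qed
      finally have "(S powr (p / a)) powr a \<le> (3 * W2 * K powr q * v k * 2 powr (\<beta> * k)) powr a"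
        using assms by (intro powr_mono2) auto
      then show ?thesis
        using assms S v(1)[of k] W K
        by (simp add: powr_powr powr_mult K'_def \<beta>_def q_def mult_ac)
    qed
    ultimately show ?thesis by blast
  qed
  show thesis by (rule that[OF K *])
qed

text \<open>Here \<delta> k is the density of E at scale 2^k. This bound is what removes the logarithmic divergence:
  once one scale satisfies the condition, the densities at all larger scales decay geometrically.\<close>

lemma allowed_scales_sum:
  fixes \<alpha> b K :: real
  assumes "\<alpha> > 0" "b > 0" "K > 0"
  obtains C where "C > 0"
    "\<And>\<delta> :: int \<Rightarrow> real. (\<And>k. 0 \<le> \<delta> k) \<Longrightarrow>
      zsum (\<lambda>k. if \<forall>m\<ge>k. \<delta> m \<le> K * 2 powr (- \<alpha> * (real_of_int m - real_of_int k))
                 then ennreal (\<delta> (k + 1) powr b) else 0) \<le> ennreal C"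
proof -
  define C where "C = K powr b * (1 / (1 - 2 powr - (\<alpha> * b)))"
  have ab: "\<alpha> * b > 0" using assms by simp
  have C: "C > 0" unfolding C_def using assms ab by (simp add: powr_less_one)
  have *: "zsum (\<lambda>k. if \<forall>m\<ge>k. \<delta> m \<le> K * 2 powr (- \<alpha> * (real_of_int m - real_of_int k))
                 then ennreal (\<delta> (k + 1) powr b) else 0) \<le> ennreal C"
    if \<delta>: "\<And>k. 0 \<le> \<delta> k" for \<delta> :: "int \<Rightarrow> real"
  proof -
    define P where "P k \<longleftrightarrow> (\<forall>m\<ge>k. \<delta> m \<le> K * 2 powr (- \<alpha> * (real_of_int m - real_of_int k)))" for k
    show ?thesis
    proof (cases "(\<exists>k. P k) \<and> (\<exists>m. \<delta> m > 0)")
      case False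
      \<comment> \<open>All terms vanish: either no scale qualifies, or every \<delta> is 0 and 0
        \<open>powr\<close> b = 0.\<close>
      then have "(if P k then ennreal (\<delta> (k + 1) powr b) else 0) = 0" for k
        using \<delta>[of "k+1"] by (auto simp: less_le)
      then show ?thesis unfolding P_def[symmetric] by (simp add: zsum_def)
    next
      case True
      then obtain k' m where k': "P k'" and m: "\<delta> m > 0" by blast
      \<comment> \<open>A qualifying k \<le> m needs \<delta> m \<le> K 2^(-\<alpha>(m - k)), which
        bounds k from below because \<delta> m > 0. So there is a least qualifying scale
        \<open>k1\<close>.\<close>
      define L where "L = min m (\<lfloor>m + log 2 (\<delta> m / K) / \<alpha>\<rfloor>)"
      have L: "L \<le> k" if "P k" for k
      proof (cases "k \<le> m")
        case True
        with that have "\<delta> m / K \<le> 2 powr (- \<alpha> * (real_of_int m - real_of_int k))"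
          using assms unfolding P_def by (auto simp: field_simps)
        then have "log 2 (\<delta> m / K) \<le> - \<alpha> * (real_of_int m - real_of_int k)"
          using m assms by (simp add: log_le_iff)
        then have "m + log 2 (\<delta> m / K) / \<alpha> \<le> k" using assms by (simp add: field_simps)
        then show ?thesis unfolding L_def by linarith
      qed (auto simp: L_def)
      obtain k1 where k1: "P k1" and least: "\<And>k. P k \<Longrightarrow> nat (k1 - L) \<le> nat (k - L)"
        using ex_has_least_nat[of P k' "\<lambda>k. nat (k - L)"] k' by blast
      have least: "k1 \<le> k" if "P k" for k using least[OF that] L[OF that] L[OF k1] by linarith
      \<comment> \<open>The condition at \<open>k1\<close> alone controls \<delta> at all later
        scales, by a geometric series whose sum does not depend on \<open>k1\<close>.\<close>
      have "zsum (\<lambda>k. if P k then ennreal (\<delta> (k + 1) powr b) else 0) \<le>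
          zsum (\<lambda>k. ennreal (K powr b) * (if k1 \<le> k then ennreal (2 powr (- (\<alpha> * b) * (real_of_int k - real_of_int k1))) else 0))"
      proof (rule zsum_mono)
        fix k
        show "(if P k then ennreal (\<delta> (k + 1) powr b) else 0) \<le>
          ennreal (K powr b) * (if k1 \<le> k then ennreal (2 powr (- (\<alpha> * b) * (real_of_int k - real_of_int k1))) else 0)"
        proof (cases "P k")
          case True
          then have "k1 \<le> k" by (rule least)
          then have "\<delta> (k + 1) \<le> K * 2 powr (- \<alpha> * (real_of_int (k + 1) - real_of_int k1))"
            using k1[unfolded P_def, rule_format, of "k + 1"] by simp
          also have "\<dots> \<le> K * 2 powr (- \<alpha> * (real_of_int k - real_of_int k1))"
            using assms by (intro mult_left_mono) auto
          finally have "\<delta> (k + 1) powr b \<le> (K * 2 powr (- \<alpha> * (real_of_int k - real_of_int k1))) powr b"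
            using \<delta> assms by (intro powr_mono2) auto
          also have "\<dots> = K powr b * 2 powr (- (\<alpha> * b) * (real_of_int k - real_of_int k1))"
            using assms by (simp add: powr_mult powr_powr algebra_simps)
          finally show ?thesis using True \<open>k1 \<le> k\<close> by (simp add: ennreal_mult[symmetric])
        qed simp
      qed
      also have "\<dots> = ennreal C"
        unfolding zsum_cmult zsum_geometric_up[OF ab] C_def using ab
        by (simp add: ennreal_mult[symmetric] powr_less_one less_imp_le)
      finally show ?thesis unfolding P_def .
    qed
  qed
  show thesis by (rule that[OF C *])
qed

section \<open>Potentials of sets\<close>

text \<open>The e_k(x) of the overview, real-valued so that \<open>powr\<close> applies. The default
  value 0 of \<open>measure\<close> at infinite mass is excluded by working with sets E of finite
  measure.\<close>

definition ball_mass :: "'a::metric_space measure \<Rightarrow> 'a set \<Rightarrow> int \<Rightarrow> 'a \<Rightarrow> real" where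
  "ball_mass \<mu> E k x = measure \<mu> (E \<inter> cball x (2 powr k))"

text \<open>A discrete Riesz potential of 1_E with kernel |x - y|^(-\<gamma>): for \<gamma> > 0 a
  point y of E other than x is counted at the scales 2^k \<ge> |x - y|, whose weights 2^(-\<gamma>
  k) form a geometric series comparable to the kernel.\<close>

definition dyadic_potential :: "real \<Rightarrow> 'a::metric_space measure \<Rightarrow> 'a set \<Rightarrow> 'a \<Rightarrow> ennreal" where
  "dyadic_potential \<gamma> \<mu> E x = zsum (\<lambda>k. ennreal (2 powr (- \<gamma> * real_of_int k) * ball_mass \<mu> E k x))"

lemma ball_mass_nonneg [simp]: "0 \<le> ball_mass \<mu> E k x"
  by (simp add: ball_mass_def)

lemma emeasure_ball_mass:
  assumes "emeasure \<mu> E < \<infinity>" "E \<in> sets \<mu>"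
  shows "emeasure \<mu> (E \<inter> cball x (2 powr k)) = ennreal (ball_mass \<mu> E k x)"
proof -
  have "emeasure \<mu> (E \<inter> cball x (2 powr k)) \<le> emeasure \<mu> E"
    using assms by (intro emeasure_mono) auto
  then show ?thesis
    using assms unfolding ball_mass_def by (intro emeasure_eq_ennreal_measure) auto
qed

text \<open>The integral form gives measurability in x and allows the exchange of integrals over
  \<mu> and \<nu>.\<close>

lemma nn_integral_ball_mass:
  fixes \<mu> :: "'a::euclidean_space measure"
  assumes "sets \<mu> = sets borel" "emeasure \<mu> E < \<infinity>" "E \<in> sets borel"
  shows "ennreal (ball_mass \<mu> E k x) = (\<integral>\<^sup>+y. indicator E y * indicator {y. dist x y \<le> 2 powr k} y \<partial>\<mu>)"
proof -
  have "(\<integral>\<^sup>+y. indicator E y * indicator {y. dist x y \<le> 2 powr k} y \<partial>\<mu>)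
    = (\<integral>\<^sup>+y. indicator (E \<inter> cball x (2 powr k)) y \<partial>\<mu>)"
    by (intro nn_integral_cong) (auto simp: indicator_def)
  also have "\<dots> = emeasure \<mu> (E \<inter> cball x (2 powr k))"
    using assms by (intro nn_integral_indicator) auto
  finally show ?thesis using emeasure_ball_mass[of \<mu> E x k] assms by simp
qed

lemma borel_measurable_ball_mass:
  fixes \<mu> :: "'a::euclidean_space measure"
  assumes \<mu>: "sets \<mu> = sets borel" "emeasure \<mu> E < \<infinity>" "E \<in> sets borel" "sigma_finite_measure \<mu>"
  shows "ball_mass \<mu> E k \<in> borel_measurable borel"
proof -
  interpret sigma_finite_measure \<mu> by fact
  note [measurable_cong] = \<mu>(1)
  note [measurable] = \<mu>(3)
  have "(\<lambda>x. \<integral>\<^sup>+y. indicator E y * indicator {y. dist x y \<le> 2 powr k} y \<partial>\<mu>) \<in> borel_measurable borel"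
    unfolding indicator_def mem_Collect_eq by measurable
  then have "(\<lambda>x. enn2real (ennreal (ball_mass \<mu> E k x))) \<in> borel_measurable borel"
    unfolding nn_integral_ball_mass[OF \<mu>(1,2,3)] by measurable
  then show ?thesis by simp
qed

text \<open>Moving the centre by at most 2^k \<le> 2^m is absorbed by doubling the radius 2^m. This
  is the source of all shifts from m to m + 1 below.\<close>

lemma ball_mass_mono:
  fixes k m :: int
  assumes "emeasure \<mu> E < \<infinity>" "E \<in> sets borel" "sets \<mu> = sets borel"
    and "dist x y \<le> 2 powr k" "k \<le> m"
  shows "ball_mass \<mu> E m y \<le> ball_mass \<mu> E (m + 1) x"
  unfolding ball_mass_def
proof (rule measure_mono_fmeasurable)
  have "2 powr real_of_int k \<le> 2 powr real_of_int m" using assms by simp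
  moreover have "2 powr real_of_int (m + 1) = 2 powr real_of_int m * 2"
    by (simp add: powr_add)
  ultimately have "dist x z \<le> 2 powr real_of_int (m + 1)" if "dist y z \<le> 2 powr real_of_int m" for z
    using that assms(4) dist_triangle[of x z y] by linarith
  then show "E \<inter> cball y (2 powr real_of_int m) \<subseteq> E \<inter> cball x (2 powr real_of_int (m + 1))" by auto
  show "E \<inter> cball y (2 powr real_of_int m) \<in> sets \<mu>" using assms by auto
  have "emeasure \<mu> (E \<inter> cball x (2 powr real_of_int (m + 1))) \<le> emeasure \<mu> E"
    using assms by (intro emeasure_mono) auto
  then show "E \<inter> cball x (2 powr real_of_int (m + 1)) \<in> fmeasurable \<mu>"
    using assms by (intro fmeasurableI) auto
qed

section \<open>Consequences of the growth condition\<close>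

lemma ball_mass_le_growth:
  fixes \<mu> :: "'a::euclidean_space measure"
  assumes "sets \<mu> = sets borel" "E \<in> sets borel" "A \<ge> 0"
    and "\<And>x r. r > 0 \<Longrightarrow> emeasure \<mu> (cball x r) \<le> ennreal (A * r powr d)"
  shows "ball_mass \<mu> E k x \<le> A * 2 powr (d * k)"
proof -
  have "emeasure \<mu> (E \<inter> cball x (2 powr k)) \<le> emeasure \<mu> (cball x (2 powr k))"
    using assms(1) by (intro emeasure_mono) auto
  also have "\<dots> \<le> ennreal (A * 2 powr (d * k))"
    using assms(4)[of "2 powr k" x] by (simp add: powr_powr mult.commute)
  finally show ?thesis
    unfolding ball_mass_def measure_def using assms(3) by (simp add: enn2real_leI)
qed

text \<open>Scales k < 0 are summable by the growth bound, with terms A 2^(\<alpha> k), and scales k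
  \<ge> 0 by the finite mass of E, with terms \<mu>(E) 2^(-(d - \<alpha>)k). So
  \<open>enn2real\<close> of the potential loses nothing.\<close>

lemma dyadic_potential_finite:
  fixes \<mu> :: "'a::euclidean_space measure"
  assumes \<mu>: "sets \<mu> = sets borel" "emeasure \<mu> E < \<infinity>" "E \<in> sets borel"
    and "0 < \<alpha>" "\<alpha> < d" "A \<ge> 0"
    and growth: "\<And>x r. r > 0 \<Longrightarrow> emeasure \<mu> (cball x r) \<le> ennreal (A * r powr d)"
  shows "dyadic_potential (d - \<alpha>) \<mu> E x < \<infinity>"
proof -
  have mE: "ball_mass \<mu> E k x \<le> measure \<mu> E" for k
    unfolding ball_mass_def using \<mu> by (intro measure_mono_fmeasurable) (auto intro: fmeasurableI)
  have "dyadic_potential (d - \<alpha>) \<mu> E x \<le> zsum (\<lambda>k. ennreal A *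
      (if k \<le> 0 then ennreal (2 powr (\<alpha> * (real_of_int k - real_of_int 0))) else 0)
      + ennreal (measure \<mu> E) *
      (if 0 \<le> k then ennreal (2 powr (- (d - \<alpha>) * (real_of_int k - real_of_int 0))) else 0))"
    unfolding dyadic_potential_def
  proof (rule zsum_mono)
    fix k
    show "ennreal (2 powr (- (d - \<alpha>) * k) * ball_mass \<mu> E k x) \<le> ennreal A *
      (if k \<le> 0 then ennreal (2 powr (\<alpha> * (real_of_int k - real_of_int 0))) else 0)
      + ennreal (measure \<mu> E) *
      (if 0 \<le> k then ennreal (2 powr (- (d - \<alpha>) * (real_of_int k - real_of_int 0))) else 0)"
    proof (cases "0 \<le> k")
      case True
      have "ennreal (2 powr (- (d - \<alpha>) * k) * ball_mass \<mu> E k x) \<le> ennreal (measure \<mu> E * 2 powr (- (d - \<alpha>) * k))"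
        using mE[of k] by (intro ennreal_leI) (simp add: mult.commute mult_left_mono)
      with True show ?thesis by (simp add: ennreal_mult[symmetric] add_increasing)
    next
      case False
      have "2 powr (- (d - \<alpha>) * k) * ball_mass \<mu> E k x \<le> 2 powr (- (d - \<alpha>) * k) * (A * 2 powr (d * k))"
        using ball_mass_le_growth[OF \<mu>(1,3) \<open>A \<ge> 0\<close> growth, of k x] by (intro mult_left_mono) auto
      also have "\<dots> = A * (2 powr (- (d - \<alpha>) * k) * 2 powr (d * k))" by (simp add: mult_ac)
      also have "2 powr (- (d - \<alpha>) * k) * 2 powr (d * k) = 2 powr (\<alpha> * k)"
        unfolding powr_add[symmetric] by (simp add: algebra_simps)
      finally show ?thesis using False \<open>A \<ge> 0\<close> by (simp add: ennreal_mult[symmetric])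
    qed
  qed
  also have "\<dots> < \<infinity>"
    unfolding zsum_add zsum_cmult zsum_geometric_down[OF \<open>0 < \<alpha>\<close>]
    using zsum_geometric_up[of "d - \<alpha>" 0] \<open>\<alpha> < d\<close>
    by (simp add: ennreal_mult_less_top)
  finally show ?thesis .
qed

text \<open>The hypotheses of the theorem on balls instead of cubes. The bound on \<nu> is asked
  only where \<mu> has positive mass, as in \<open>ratio_sup\<close>; the exponent t will be d -
  \<alpha> p.\<close>

definition trace_pair ::
  "real \<Rightarrow> real \<Rightarrow> real \<Rightarrow> real \<Rightarrow> 'a::euclidean_space measure \<Rightarrow> 'a measure \<Rightarrow> bool" where
  "trace_pair A d B t \<mu> \<nu> \<longleftrightarrow>
     sets \<mu> = sets borel \<and> sets \<nu> = sets borel \<and> sigma_finite_measure \<mu> \<and> sigma_finite_measure \<nu> \<and>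
     (\<forall>x r. r > 0 \<longrightarrow> emeasure \<mu> (cball x r) \<le> ennreal (A * r powr d)) \<and>
     (\<forall>x r. r > 0 \<longrightarrow> emeasure \<mu> (cball x r) > 0 \<longrightarrow> emeasure \<nu> (cball x r) \<le> ennreal (B * r powr t))"

text \<open>The case f = 1_E: the Lorentz norm of 1_E is p \<mu>(E)^(1/p), so \<mu>(E) is its p-th
  power up to a constant. The proof is the selection of scales followed by an exchange of
  integrals.\<close>

lemma restricted_trace_inequality:
  fixes \<alpha> d p A B :: real
  assumes "0 < \<alpha>" "\<alpha> < d" "1 < p" "A > 0" "B > 0"
  shows "\<exists>C>0. \<forall>(\<mu> :: 'a::euclidean_space measure) \<nu> E.
    trace_pair A d B (d - \<alpha> * p) \<mu> \<nu> \<longrightarrow> E \<in> sets borel \<longrightarrow> emeasure \<mu> E < \<infinity> \<longrightarrow>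
    (\<integral>\<^sup>+x. ennreal (enn2real (dyadic_potential (d - \<alpha>) \<mu> E x) powr p) \<partial>\<nu>) \<le> ennreal (C * measure \<mu> E)"
proof -
  \<comment> \<open>Any exponent strictly between 1 and p would do: a < p serves the selection of a
    scale, and a > 1 leaves a positive power a - 1 of the density to be summed.\<close>
  define a where "a = (1 + p) / 2"
  have a: "1 < a" "a < p" using assms by (auto simp: a_def)
  then have a0: "0 < a" and a1: "0 < a - 1" by auto
  obtain K K' where K: "K > 0" "K' > 0" and
    dominant: "\<And>(v :: int \<Rightarrow> real) S. \<lbrakk>\<And>k. 0 \<le> v k; \<And>k. v k \<le> A * 2 powr (\<alpha> * k); S > 0;
       zsum (\<lambda>k. ennreal (v k)) = ennreal S\<rbrakk> \<Longrightarrow>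
       \<exists>k. S \<le> K * 2 powr (\<alpha> * k) \<and> S powr p \<le> K' * (v k powr a * 2 powr (\<alpha> * k * (p - a)))"
    using dominant_scale[OF assms(1,4) a0 a(2)] by blast
  \<comment> \<open>The factor 2^(d - \<alpha>) pays for comparing e_m(y) with e_(m+1)(x).\<close>
  define L where "L = K * 2 powr (d - \<alpha>)"
  have L: "L > 0" using K by (simp add: L_def)
  obtain C1 where C1: "C1 > 0" and allowed:
    "\<And>\<delta> :: int \<Rightarrow> real. (\<And>k. 0 \<le> \<delta> k) \<Longrightarrow>
      zsum (\<lambda>k. if \<forall>m\<ge>k. \<delta> m \<le> L * 2 powr (- \<alpha> * (real_of_int m - real_of_int k))
                 then ennreal (\<delta> (k + 1) powr (a - 1)) else 0) \<le> ennreal C1"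
    using allowed_scales_sum[OF assms(1) a1 L] by blast
  \<comment> \<open>The first power of 2 comes from using the \<nu>-bound at radius 2^(k+1), the
    second from rewriting e_(k+1)(y) through the density at scale k + 1.\<close>
  define B1 where "B1 = B * 2 powr (d - \<alpha> * p) * 2 powr (d * (a - 1))"
  have B1: "B1 > 0" using assms by (simp add: B1_def)
  show ?thesis
  proof (intro exI[of _ "K' * (B1 * C1)"] conjI allI impI)
    show "0 < K' * (B1 * C1)" using K B1 C1 by simp
    fix \<mu> \<nu> :: "'a measure" and E
    assume "trace_pair A d B (d - \<alpha> * p) \<mu> \<nu>"
    then have \<mu>: "sets \<mu> = sets borel" and \<nu>: "sets \<nu> = sets borel"
      and sf: "sigma_finite_measure \<mu>" "sigma_finite_measure \<nu>"
      and growth: "\<And>x r. r > 0 \<Longrightarrow> emeasure \<mu> (cball x r) \<le> ennreal (A * r powr d)"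
      and trace: "\<And>x r. r > 0 \<Longrightarrow> emeasure \<mu> (cball x r) > 0 \<Longrightarrow>
                  emeasure \<nu> (cball x r) \<le> ennreal (B * r powr (d - \<alpha> * p))"
      by (auto simp: trace_pair_def)
    assume E: "E \<in> sets borel" and Efin: "emeasure \<mu> E < \<infinity>"
    interpret \<mu>: sigma_finite_measure \<mu> by fact
    interpret \<nu>: sigma_finite_measure \<nu> by fact
    interpret pair_sigma_finite \<nu> \<mu> ..
    note [measurable_cong] = \<mu> \<nu>
    note [measurable] = E
    note e_meas = borel_measurable_ball_mass[OF \<mu> Efin E sf(1)]
    define e where "e = ball_mass \<mu> E"
    have e_nonneg [simp]: "0 \<le> e k x" for k x by (simp add: e_def)
    have [measurable]: "e k \<in> borel_measurable borel" for k using e_meas by (simp add: e_def)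
    define S where "S x = enn2real (dyadic_potential (d - \<alpha>) \<mu> E x)" for x
    have S_eq: "zsum (\<lambda>k. ennreal (2 powr (- (d - \<alpha>) * k) * e k x)) = ennreal (S x)" for x
      using dyadic_potential_finite[OF \<mu> Efin E assms(1,2) _ growth, of x] assms
      unfolding S_def dyadic_potential_def e_def by simp
    have S_nonneg [simp]: "0 \<le> S x" for x by (simp add: S_def)
    have [measurable]: "S \<in> borel_measurable borel"
      unfolding S_def dyadic_potential_def e_def[symmetric] by measurable
    \<comment> \<open>The cutoff keeps the scales with the first property. Of e_k(x)^a one factor
      e_k(x) is set aside, to become an integral over E.\<close>
    define T where "T k x = (if S x \<le> K * 2 powr (\<alpha> * real_of_int k) then e k x powr (a - 1) else 0)" for k x
    have T_nonneg [simp]: "0 \<le> T k x" for k x by (simp add: T_def)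
    have [measurable]: "T k \<in> borel_measurable borel" for k unfolding T_def by measurable
    \<comment> \<open>The exponent is -(d - \<alpha>)a + \<alpha>(p - a), collected from v_k^a
      2^(\<alpha> k(p - a)).\<close>
    define c where "c k = 2 powr ((\<alpha> * p - d * a) * real_of_int k)" for k
    have c_nonneg [simp]: "0 \<le> c k" for k by (simp add: c_def)

    \<comment> \<open>The selected scale depends on x; summing over all scales kept by
      \<open>T\<close> removes this dependence.\<close>
    have pointwise: "ennreal (S x powr p) \<le> ennreal K' * zsum (\<lambda>k. ennreal (c k * T k x) * ennreal (e k x))" for x
    proof (cases "S x = 0")
      case True
      then show ?thesis by simp
    next
      case False
      then have Spos: "S x > 0" using S_nonneg[of x] by linarith
      have "2 powr (- (d - \<alpha>) * k) * e k x \<le> A * 2 powr (\<alpha> * k)" for k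
      proof -
        have "2 powr (- (d - \<alpha>) * k) * e k x \<le> 2 powr (- (d - \<alpha>) * k) * (A * 2 powr (d * k))"
          unfolding e_def using ball_mass_le_growth[OF \<mu> E _ growth, of k x] assms
          by (intro mult_left_mono) auto
        also have "\<dots> = A * (2 powr (- (d - \<alpha>) * k) * 2 powr (d * k))" by (simp add: mult_ac)
        also have "2 powr (- (d - \<alpha>) * k) * 2 powr (d * k) = 2 powr (\<alpha> * k)"
          unfolding powr_add[symmetric] by (simp add: algebra_simps)
        finally show ?thesis .
      qed
      from dominant[OF _ this Spos S_eq] obtain k where k: "S x \<le> K * 2 powr (\<alpha> * k)"
        "S x powr p \<le> K' * ((2 powr (- (d - \<alpha>) * k) * e k x) powr a * 2 powr (\<alpha> * k * (p - a)))"
        by auto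
      have "(2 powr (- (d - \<alpha>) * k) * e k x) powr a * 2 powr (\<alpha> * k * (p - a))
          = (2 powr (- (d - \<alpha>) * k * a) * 2 powr (\<alpha> * k * (p - a))) * e k x powr a"
        by (simp add: powr_mult powr_powr)
      also have "2 powr (- (d - \<alpha>) * k * a) * 2 powr (\<alpha> * k * (p - a)) = c k"
        unfolding c_def powr_add[symmetric] by (simp add: algebra_simps)
      also have "e k x powr a = T k x * e k x"
        using k(1) a e_nonneg[of k x] by (cases "e k x = 0") (auto simp: T_def powr_diff)
      finally have "S x powr p \<le> K' * (c k * T k x * e k x)" using k(2) by (simp add: mult_ac)
      then have "ennreal (S x powr p) \<le> ennreal K' * (ennreal (c k * T k x) * ennreal (e k x))"
        using K by (simp add: ennreal_mult[symmetric])
      also have "\<dots> \<le> ennreal K' * zsum (\<lambda>k. ennreal (c k * T k x) * ennreal (e k x))"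
        by (intro mult_left_mono zsum_ge_term[of "\<lambda>k. ennreal (c k * T k x) * ennreal (e k x)"]) auto
      finally show ?thesis .
    qed

    \<comment> \<open>What remains at y in E once the \<nu>-integral has become the inner
      one.\<close>
    define \<Phi> where "\<Phi> k y = (\<integral>\<^sup>+x. ennreal (c k * T k x) * indicator {x. dist x y \<le> 2 powr real_of_int k} x \<partial>\<nu>)" for k y
    have swap: "(\<integral>\<^sup>+x. ennreal (c k * T k x) * ennreal (e k x) \<partial>\<nu>) = (\<integral>\<^sup>+y. indicator E y * \<Phi> k y \<partial>\<mu>)" for k
    proof -
      have "(\<integral>\<^sup>+x. ennreal (c k * T k x) * ennreal (e k x) \<partial>\<nu>)
         = (\<integral>\<^sup>+x. (\<integral>\<^sup>+y. ennreal (c k * T k x) * (indicator E y * indicator {y. dist x y \<le> 2 powr real_of_int k} y) \<partial>\<mu>) \<partial>\<nu>)"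
        unfolding e_def nn_integral_ball_mass[OF \<mu> Efin E]
        by (intro nn_integral_cong nn_integral_cmult[symmetric]) (unfold indicator_def mem_Collect_eq, measurable)
      also have "\<dots> = (\<integral>\<^sup>+y. (\<integral>\<^sup>+x. ennreal (c k * T k x) * (indicator E y * indicator {y. dist x y \<le> 2 powr real_of_int k} y) \<partial>\<nu>) \<partial>\<mu>)"
        by (intro Fubini'[symmetric]) (unfold indicator_def mem_Collect_eq, measurable)
      also have "\<dots> = (\<integral>\<^sup>+y. (\<integral>\<^sup>+x. indicator E y * (ennreal (c k * T k x) * indicator {x. dist x y \<le> 2 powr real_of_int k} x) \<partial>\<nu>) \<partial>\<mu>)"
        by (intro nn_integral_cong) (auto simp: indicator_def)
      also have "\<dots> = (\<integral>\<^sup>+y. indicator E y * \<Phi> k y \<partial>\<mu>)"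
        unfolding \<Phi>_def
        by (intro nn_integral_cong nn_integral_cmult) (unfold indicator_def mem_Collect_eq, measurable)
      finally show ?thesis .
    qed
    have \<Phi>_meas [measurable]: "\<Phi> k \<in> borel_measurable borel" for k
      unfolding \<Phi>_def indicator_def mem_Collect_eq by measurable

    have \<Phi>_sum: "zsum (\<lambda>k. \<Phi> k y) \<le> ennreal (B1 * C1)" for y
    proof -
      define \<delta> where "\<delta> m = 2 powr (- d * real_of_int m) * e m y" for m
      define P where "P k \<longleftrightarrow> (\<forall>m\<ge>k. \<delta> m \<le> L * 2 powr (- \<alpha> * (real_of_int m - real_of_int k)))" for k
      have "\<Phi> k y \<le> ennreal B1 * (if P k then ennreal (\<delta> (k + 1) powr (a - 1)) else 0)" for k
      proof -
        \<comment> \<open>One such x near y suffices: S(x) dominates its term at scale m + 1, and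
          e_(m+1)(x) dominates e_m(y).\<close>
        have allowedP: "P k" if x: "dist x y \<le> 2 powr k" "S x \<le> K * 2 powr (\<alpha> * k)" for x
          unfolding P_def
        proof (intro allI impI)
          fix m assume "k \<le> m"
          have "ennreal (2 powr (- (d - \<alpha>) * (m + 1)) * e (m + 1) x) \<le> ennreal (S x)"
            unfolding S_eq[symmetric]
            using zsum_ge_term[of "\<lambda>k. ennreal (2 powr (- (d - \<alpha>) * k) * e k x)" "m + 1"] by simp
          then have "2 powr (- (d - \<alpha>) * (m + 1)) * e (m + 1) x \<le> K * 2 powr (\<alpha> * k)"
            using x(2) by (simp add: ennreal_le_iff)
          moreover have "e m y \<le> e (m + 1) x"
            unfolding e_def using ball_mass_mono[OF Efin E \<mu> x(1) \<open>k \<le> m\<close>] .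
          ultimately have *: "2 powr (- (d - \<alpha>) * (m + 1)) * e m y \<le> K * 2 powr (\<alpha> * k)"
            by (meson mult_left_mono order_trans powr_ge_zero)
          have "\<delta> m = 2 powr ((d - \<alpha>) - \<alpha> * m) * (2 powr (- (d - \<alpha>) * (m + 1)) * e m y)"
            unfolding \<delta>_def mult.assoc[symmetric] powr_add[symmetric] by (simp add: algebra_simps)
          also have "\<dots> \<le> 2 powr ((d - \<alpha>) - \<alpha> * m) * (K * 2 powr (\<alpha> * k))"
            using * by (intro mult_left_mono) auto
          also have "\<dots> = K * (2 powr ((d - \<alpha>) - \<alpha> * m) * 2 powr (\<alpha> * k))" by (simp add: mult_ac)
          also have "\<dots> = L * 2 powr (- \<alpha> * (real_of_int m - real_of_int k))"
            unfolding L_def mult.assoc powr_add[symmetric] by (simp add: algebra_simps)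
          finally show "\<delta> m \<le> L * 2 powr (- \<alpha> * (real_of_int m - real_of_int k))" .
        qed
        \<comment> \<open>The comparison of masses now runs from x to y, which is why the density at
          k + 1 appears in \<open>allowed\<close>.\<close>
        have T_le: "T k x \<le> (if P k then e (k + 1) y powr (a - 1) else 0)" if "dist x y \<le> 2 powr k" for x
        proof (cases "S x \<le> K * 2 powr (\<alpha> * k)")
          case True
          have "e k x \<le> e (k + 1) y"
            unfolding e_def using ball_mass_mono[OF Efin E \<mu>, of y x k k] that by (simp add: dist_commute)
          then show ?thesis using allowedP[OF that True] a by (auto simp: T_def intro!: powr_mono2)
        qed (auto simp: T_def)
        show ?thesis
        proof (cases "P k \<and> e (k + 1) y > 0")
          case False
          then have "T k x = 0" if "dist x y \<le> 2 powr k" for x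
            using T_le[OF that] T_nonneg[of k x] e_nonneg[of "k + 1" y] by (auto simp: less_le split: if_splits intro: antisym)
          then have "\<Phi> k y = (\<integral>\<^sup>+x. 0 \<partial>\<nu>)"
            unfolding \<Phi>_def by (intro nn_integral_cong) (auto simp: indicator_def)
          then show ?thesis by simp
        next
          case True
          have "\<Phi> k y \<le> (\<integral>\<^sup>+x. ennreal (c k * e (k + 1) y powr (a - 1)) * indicator (cball y (2 powr k)) x \<partial>\<nu>)"
            unfolding \<Phi>_def using True T_le
            by (intro nn_integral_mono) (auto simp: indicator_def dist_commute intro!: ennreal_leI mult_left_mono)
          also have "\<dots> = ennreal (c k * e (k + 1) y powr (a - 1)) * emeasure \<nu> (cball y (2 powr k))"
            by (intro nn_integral_cmult_indicator) (auto simp: \<nu>)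
          \<comment> \<open>Positive \<mu>-mass is known for the ball of radius 2^(k+1), by
            e_(k+1)(y) > 0, but perhaps not for radius 2^k. So the \<nu>-bound is applied to the
            larger ball.\<close>
          also have "emeasure \<nu> (cball y (2 powr k)) \<le> ennreal (B * 2 powr ((d - \<alpha> * p) * (k + 1)))"
          proof -
            have "0 < ennreal (e (k + 1) y)" using True by simp
            also have "\<dots> \<le> emeasure \<mu> (cball y (2 powr (k + 1)))"
              unfolding e_def emeasure_ball_mass[OF Efin, unfolded \<mu>, OF E, symmetric]
              by (intro emeasure_mono) (auto simp: \<mu>)
            finally have "emeasure \<nu> (cball y (2 powr (k + 1))) \<le> ennreal (B * 2 powr ((d - \<alpha> * p) * (k + 1)))"
              using trace[of "2 powr (k + 1)" y] by (simp add: powr_powr mult.commute)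
            moreover have "emeasure \<nu> (cball y (2 powr k)) \<le> emeasure \<nu> (cball y (2 powr (k + 1)))"
              by (intro emeasure_mono subset_cball) (auto simp: \<nu>)
            ultimately show ?thesis by order
          qed
          finally have "\<Phi> k y \<le> ennreal (c k * e (k + 1) y powr (a - 1)) * ennreal (B * 2 powr ((d - \<alpha> * p) * (k + 1)))"
            by (simp add: mult_left_mono)
          also have "\<dots> = ennreal (B * (c k * 2 powr ((d - \<alpha> * p) * (k + 1))) * e (k + 1) y powr (a - 1))"
            using assms by (simp add: ennreal_mult[symmetric] mult_ac)
          also have "B * (c k * 2 powr ((d - \<alpha> * p) * (k + 1))) * e (k + 1) y powr (a - 1) = B1 * \<delta> (k + 1) powr (a - 1)"
          proof -
            have "c k * 2 powr ((d - \<alpha> * p) * (k + 1)) = 2 powr (d - \<alpha> * p) * 2 powr (d * (a - 1)) * 2 powr (- d * (k + 1) * (a - 1))"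
              unfolding c_def powr_add[symmetric] by (simp add: algebra_simps)
            then show ?thesis
              unfolding B1_def \<delta>_def by (simp add: powr_mult powr_powr)
          qed
          finally show ?thesis using True B1 by (simp add: ennreal_mult[symmetric])
        qed
      qed
      then have "zsum (\<lambda>k. \<Phi> k y) \<le> zsum (\<lambda>k. ennreal B1 * (if P k then ennreal (\<delta> (k + 1) powr (a - 1)) else 0))"
        by (rule zsum_mono)
      also have "\<dots> \<le> ennreal B1 * ennreal C1"
        unfolding zsum_cmult P_def using allowed[of \<delta>]
        by (intro mult_left_mono) (auto simp: \<delta>_def)
      finally show ?thesis using B1 C1 by (simp add: ennreal_mult)
    qed

    have "(\<integral>\<^sup>+x. ennreal (S x powr p) \<partial>\<nu>) \<le> (\<integral>\<^sup>+x. ennreal K' * zsum (\<lambda>k. ennreal (c k * T k x) * ennreal (e k x)) \<partial>\<nu>)"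
      by (intro nn_integral_mono pointwise)
    also have "\<dots> = ennreal K' * zsum (\<lambda>k. \<integral>\<^sup>+x. ennreal (c k * T k x) * ennreal (e k x) \<partial>\<nu>)"
      by (subst nn_integral_cmult, measurable, subst nn_integral_zsum, measurable)
    also have "\<dots> = ennreal K' * (\<integral>\<^sup>+y. zsum (\<lambda>k. indicator E y * \<Phi> k y) \<partial>\<mu>)"
      unfolding swap by (subst nn_integral_zsum) measurable
    also have "\<dots> \<le> ennreal K' * (\<integral>\<^sup>+y. ennreal (B1 * C1) * indicator E y \<partial>\<mu>)"
      using \<Phi>_sum unfolding zsum_cmult
      by (intro mult_left_mono nn_integral_mono) (auto simp: indicator_def)
    also have "\<dots> = ennreal K' * (ennreal (B1 * C1) * emeasure \<mu> E)"
      by (subst nn_integral_cmult_indicator) (auto simp: \<mu>)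
    also have "emeasure \<mu> E = ennreal (measure \<mu> E)"
      using Efin by (intro emeasure_eq_ennreal_measure) auto
    finally show "(\<integral>\<^sup>+x. ennreal (enn2real (dyadic_potential (d - \<alpha>) \<mu> E x) powr p) \<partial>\<nu>)
        \<le> ennreal (K' * (B1 * C1) * measure \<mu> E)"
      using K B1 C1 by (simp add: S_def ennreal_mult[symmetric] mult.assoc)
  qed
qed

section \<open>Dyadic levels and the Lorentz norm\<close>

text \<open>Jensen's inequality for the p-th power with weights w_j of total at most 1, applied to
  h_j / w_j. It follows from Young's inequality term by term.\<close>

lemma zsum_le_powr_mean:
  fixes h w :: "int \<Rightarrow> real"
  assumes p: "1 < p" and h: "\<And>j. 0 \<le> h j" and w: "\<And>j. 0 \<le> w j" "\<And>j. w j = 0 \<Longrightarrow> h j = 0"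
    and w_sum: "zsum (\<lambda>j. ennreal (w j)) \<le> 1"
    and r: "0 \<le> r" "zsum (\<lambda>j. ennreal (w j powr (1 - p) * h j powr p)) = ennreal r"
  shows "zsum (\<lambda>j. ennreal (h j)) \<le> ennreal (r powr (1 / p))"
proof (cases "r = 0")
  case True
  have "h j = 0" for j
  proof -
    have "ennreal (w j powr (1 - p) * h j powr p) \<le> 0"
      using zsum_ge_term[of "\<lambda>j. ennreal (w j powr (1 - p) * h j powr p)" j] r True by simp
    then show ?thesis using w(2)[of j] by (auto simp: ennreal_eq_0_iff mult_le_0_iff)
  qed
  then show ?thesis by (simp add: zsum_def)
next
  case False
  define l where "l = r powr (1 / p)"
  define q where "q = p / (p - 1)"
  have l: "l > 0" using False r by (simp add: l_def)
  have q: "q > 1" "1 / p + 1 / q = 1" using p by (auto simp: q_def field_simps)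
  have lp: "l powr p = r" using False r p by (simp add: l_def powr_powr)
  \<comment> \<open>Young's inequality for h_j / w_j and l^(p - 1), multiplied by w_j l^(1 - p).
    With l^p = r the sum of the right sides is at most l(1/p + 1/q) = l.\<close>
  have "h j \<le> (l powr (1 - p) / p) * (w j powr (1 - p) * h j powr p) + (l / q) * w j" for j
  proof (cases "w j = 0")
    case False
    then have wj: "w j > 0" using w(1)[of j] by simp
    have "(h j / w j) * l powr (p - 1) \<le> (h j / w j) powr p / p + (l powr (p - 1)) powr q / q"
      using Youngs_inequality[of p q "h j / w j" "l powr (p - 1)"] p q h[of j] wj by simp
    also have "(l powr (p - 1)) powr q = l powr p" using p by (simp add: powr_powr q_def)
    finally have "(h j / w j) * l powr (p - 1) * (w j * l powr (1 - p))
        \<le> ((h j / w j) powr p / p + l powr p / q) * (w j * l powr (1 - p))"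
      using wj by (intro mult_right_mono) auto
    moreover have l1: "l powr (p - 1) * l powr (1 - p) = 1" "l powr p * l powr (1 - p) = l"
      using l by (auto simp: powr_add[symmetric])
    moreover have "(h j / w j) * l powr (p - 1) * (w j * l powr (1 - p)) = h j"
      using wj l1 by (simp add: field_simps)
    moreover have "((h j / w j) powr p / p + l powr p / q) * (w j * l powr (1 - p))
        = (l powr (1 - p) / p) * ((h j / w j) powr p * w j) + (l powr p * l powr (1 - p)) / q * w j"
      by (simp add: field_simps)
    moreover have "(h j / w j) powr p * w j = w j powr (1 - p) * h j powr p"
      using wj h[of j] by (simp add: powr_divide powr_diff)
    ultimately show ?thesis by metis
  qed (use w in auto)
  then have "zsum (\<lambda>j. ennreal (h j)) \<le> zsum (\<lambda>j. ennreal (l powr (1 - p) / p) * ennreal (w j powr (1 - p) * h j powr p) + ennreal (l / q) * ennreal (w j))"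
    using w(1) h p q l
    by (intro zsum_mono) (simp add: ennreal_mult[symmetric] ennreal_plus[symmetric] del: ennreal_plus)
  also have "\<dots> = ennreal (l powr (1 - p) / p) * ennreal r + ennreal (l / q) * zsum (\<lambda>j. ennreal (w j))"
    unfolding zsum_add zsum_cmult r(2) ..
  also have "\<dots> \<le> ennreal (l powr (1 - p) / p) * ennreal r + ennreal (l / q) * 1"
    by (intro add_left_mono mult_left_mono w_sum) auto
  also have "\<dots> = ennreal (l powr (1 - p) / p * r + l / q)"
    using p q r l by (simp add: ennreal_mult[symmetric] ennreal_plus[symmetric] del: ennreal_plus)
  also have "l powr (1 - p) / p * r + l / q = l * (1 / p + 1 / q)"
    unfolding lp[symmetric] using l by (simp add: powr_add[symmetric] algebra_simps)
  finally show ?thesis using q(2) by (simp add: l_def)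
qed

section \<open>Level sets and the decreasing rearrangement\<close>

lemma nn_integral_powr_lessThan:
  fixes q T :: real
  assumes "0 < q" "0 \<le> T"
  shows "(\<integral>\<^sup>+t\<in>{0<..}. ennreal (t powr (q - 1)) * indicator {..<T} t \<partial>lborel) = ennreal (T powr q / q)"
proof -
  have "((\<lambda>t. t powr (q - 1)) has_integral (T powr q / q)) {0..T}"
    using has_integral_powr_from_0[of "q - 1" T] assms by simp
  then have "(\<integral>\<^sup>+t. ennreal (t powr (q - 1)) * indicator {0..T} t \<partial>lborel) = ennreal (T powr q / q)"
    by (intro nn_integral_has_integral_lebesgue') auto
  moreover have "(\<integral>\<^sup>+t\<in>{0<..}. ennreal (t powr (q - 1)) * indicator {..<T} t \<partial>lborel) =
     (\<integral>\<^sup>+t. ennreal (t powr (q - 1)) * indicator {0..T} t \<partial>lborel)"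
  proof (intro nn_integral_cong_AE)
    show "AE t in lborel. ennreal (t powr (q - 1)) * indicator {..<T} t * indicator {0<..} t
       = ennreal (t powr (q - 1)) * indicator {0..T} t"
      using AE_lborel_singleton[of 0] AE_lborel_singleton[of T]
      by eventually_elim (auto simp: indicator_def)
  qed
  ultimately show ?thesis by simp
qed

text \<open>A competitor u < s in the infimum would have an even larger level set, of measure above
  t.\<close>

lemma rearrangement_ge:
  assumes f: "f \<in> borel_measurable (completion M)"
    and "ennreal t < emeasure (completion M) {x \<in> space M. s < \<bar>f x\<bar>}"
  shows "ennreal s \<le> rearrangement M f t"
  unfolding rearrangement_def
proof (rule Inf_greatest, clarify)
  fix u :: real
  assume "0 < u" and u: "emeasure (completion M) {x \<in> space M. u < \<bar>f x\<bar>} \<le> ennreal t"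
  show "ennreal s \<le> ennreal u"
  proof (rule ccontr)
    assume "\<not> ?thesis"
    then have "u < s" by (meson ennreal_leI not_le)
    then have "emeasure (completion M) {x \<in> space M. s < \<bar>f x\<bar>} \<le> emeasure (completion M) {x \<in> space M. u < \<bar>f x\<bar>}"
    proof (intro emeasure_mono)
      have "{x \<in> space (completion M). u < \<bar>f x\<bar>} \<in> sets (completion M)"
        using f by measurable
      then show "{x \<in> space M. u < \<bar>f x\<bar>} \<in> sets (completion M)" by simp
    qed auto
    with assms(2) u show False by order
  qed
qed

text \<open>A Chebyshev inequality: the rearrangement is at least s on (0, T). Taking a real T below
  the measure of the level set also covers level sets of infinite measure.\<close>

lemma lorentz_norm_ge:
  assumes f: "f \<in> borel_measurable (completion M)" and p: "0 < p" and s: "0 \<le> s"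
    and T: "0 \<le> T" "ennreal T \<le> emeasure (completion M) {x \<in> space M. s < \<bar>f x\<bar>}"
  shows "ennreal (s * p * T powr (1 / p)) \<le> lorentz_norm p M f"
proof -
  have "ennreal (s * p * T powr (1 / p)) = ennreal s * (\<integral>\<^sup>+t\<in>{0<..}. ennreal (t powr (1 / p - 1)) * indicator {..<T} t \<partial>lborel)"
    using nn_integral_powr_lessThan[of "1 / p" T] p s T by (simp add: ennreal_mult[symmetric] mult_ac)
  also have "\<dots> = (\<integral>\<^sup>+t. ennreal s * (ennreal (t powr (1 / p - 1)) * indicator {..<T} t * indicator {0<..} t) \<partial>lborel)"
    by (intro nn_integral_cmult[symmetric]) measurable
  also have "\<dots> \<le> lorentz_norm p M f"
    unfolding lorentz_norm_def
  proof (intro nn_integral_mono)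
    fix t :: real
    show "ennreal s * (ennreal (t powr (1 / p - 1)) * indicator {..<T} t * indicator {0<..} t)
      \<le> ennreal (t powr (1 / p - 1)) * rearrangement M f t * indicator {0<..} t"
    proof (cases "0 < t \<and> t < T")
      case True
      then have "ennreal t < ennreal T" by (intro ennreal_lessI) auto
      then have "ennreal s \<le> rearrangement M f t"
        using T(2) by (intro rearrangement_ge f) order
      then show ?thesis using True by (simp add: mult.commute mult_right_mono)
    qed (auto simp: indicator_def)
  qed
  finally show ?thesis .
qed

lemma lorentz_norm_finite_level:
  assumes f: "f \<in> lorentz_space p M" and p: "0 < p" and s: "0 < s"
  shows "emeasure (completion M) {x \<in> space M. s < \<bar>f x\<bar>} < \<infinity>"
proof (rule ccontr)
  assume "\<not> ?thesis"
  then have inf: "emeasure (completion M) {x \<in> space M. s < \<bar>f x\<bar>} = \<infinity>"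
    by (metis infinity_ennreal_def top.not_eq_extremum)
  define l where "l = enn2real (lorentz_norm p M f)"
  have l: "lorentz_norm p M f = ennreal l" "0 \<le> l"
    using f by (auto simp: lorentz_space_def l_def)
  \<comment> \<open>Chosen so that s p T^(1/p) = l + 1 exceeds the norm l.\<close>
  define T where "T = ((l + 1) / (s * p)) powr p"
  have "T powr (1 / p) = (l + 1) / (s * p)" unfolding T_def using p s l by (simp add: powr_powr)
  moreover have "ennreal (s * p * T powr (1 / p)) \<le> lorentz_norm p M f"
    using f p s by (intro lorentz_norm_ge) (auto simp: lorentz_space_def inf T_def)
  ultimately have "ennreal (l + 1) \<le> ennreal l" using l s p by simp
  then show False using l by simp
qed

text \<open>Every level 2^j that is counted lies below the rearrangement at t. Up to the largest
  such level the powers of 2 add up to at most twice that level, whence the division by 2.\<close>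

lemma zsum_dyadic_levels_le_rearrangement:
  assumes f: "f \<in> borel_measurable (completion M)"
  shows "zsum (\<lambda>j. if ennreal t < emeasure (completion M) {x \<in> space M. 2 powr real_of_int j < \<bar>f x\<bar>}
      then ennreal (2 powr real_of_int j / 2) else 0) \<le> rearrangement M f t"
proof -
  define P where "P j \<longleftrightarrow> ennreal t < emeasure (completion M) {x \<in> space M. 2 powr real_of_int j < \<bar>f x\<bar>}" for j :: int
  have ge: "ennreal (2 powr j) \<le> rearrangement M f t" if "P j" for j
    using that unfolding P_def by (intro rearrangement_ge[OF f])
  have "zsum (\<lambda>j. if P j then ennreal (2 powr j / 2) else 0) \<le> rearrangement M f t"
  proof (cases "\<exists>J. \<forall>j. P j \<longrightarrow> j \<le> J")
    case False
    \<comment> \<open>Arbitrarily large levels are counted, and the rearrangement dominates each of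
      them.\<close>
    have "rearrangement M f t = \<infinity>"
    proof (rule ccontr)
      assume "\<not> ?thesis"
      then obtain r where r: "0 \<le> r" "rearrangement M f t = ennreal r"
        by (cases "rearrangement M f t") auto
      from False obtain j where j: "P j" "\<lceil>log 2 (r + 1)\<rceil> < j" by (meson not_le)
      then have "log 2 (r + 1) \<le> j" by linarith
      then have "r + 1 \<le> 2 powr j" using r by (simp add: log_le_iff)
      moreover have "2 powr j \<le> r" using ge[OF j(1)] r by simp
      ultimately show False by simp
    qed
    then show ?thesis by simp
  next
    case bounded: True
    then obtain J where J: "\<And>j. P j \<Longrightarrow> j \<le> J" by blast
    show ?thesis
    proof (cases "\<exists>j. P j")
      case False
      then show ?thesis by (simp add: zsum_def)
    next
      case True
      then obtain j0 where "P j0" by blast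
      then obtain j1 where j1: "P j1" and least: "\<And>j. P j \<Longrightarrow> nat (J - j1) \<le> nat (J - j)"
        using ex_has_least_nat[of P j0 "\<lambda>j. nat (J - j)"] by blast
      have top: "j \<le> j1" if "P j" for j using least[OF that] J[OF that] J[OF j1] by linarith
      have "zsum (\<lambda>j. if P j then ennreal (2 powr j / 2) else 0) \<le>
        zsum (\<lambda>j. ennreal (2 powr j1 / 2) * (if j \<le> j1 then ennreal (2 powr (1 * (real_of_int j - real_of_int j1))) else 0))"
        using top by (intro zsum_mono) (auto simp: ennreal_mult[symmetric] powr_add[symmetric])
      also have "\<dots> = ennreal (2 powr j1)"
        unfolding zsum_cmult
        by (subst zsum_geometric_down, simp, subst ennreal_mult[symmetric]) (auto simp: powr_minus)
      also have "\<dots> \<le> rearrangement M f t" by (rule ge[OF j1])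
      finally show ?thesis .
    qed
  qed
  then show ?thesis unfolding P_def .
qed

text \<open>The preceding bound is integrated against t^(1/p - 1); level j is counted for t <
  \<open>D j\<close>, which contributes p D_j^(1/p) times 2^j / 2.\<close>

lemma zsum_dyadic_levels_le_lorentz_norm:
  assumes f: "f \<in> lorentz_space p M" and p: "0 < p"
  shows "zsum (\<lambda>j. ennreal (2 powr real_of_int j *
      measure (completion M) {x \<in> space M. 2 powr real_of_int j < \<bar>f x\<bar>} powr (1 / p)))
    \<le> ennreal (2 / p) * lorentz_norm p M f"
proof -
  define D where "D j = measure (completion M) {x \<in> space M. 2 powr real_of_int j < \<bar>f x\<bar>}" for j :: int
  have D: "emeasure (completion M) {x \<in> space M. 2 powr real_of_int j < \<bar>f x\<bar>} = ennreal (D j)" for j :: int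
    unfolding D_def
  proof (rule emeasure_eq_ennreal_measure)
    show "emeasure (completion M) {x \<in> space M. 2 powr real_of_int j < \<bar>f x\<bar>} \<noteq> top"
      using lorentz_norm_finite_level[OF f p, of "2 powr j"]
      by (simp only: less_top infinity_ennreal_def powr_gt_zero)
  qed
  have D_nonneg: "0 \<le> D j" for j unfolding D_def by (rule measure_nonneg)
  have fm: "f \<in> borel_measurable (completion M)" using f by (simp add: lorentz_space_def)
  have int: "(\<integral>\<^sup>+t\<in>{0<..}. ennreal (t powr (1 / p - 1)) * indicator {..<D j} t \<partial>lborel) = ennreal (D j powr (1 / p) / (1 / p))" for j
    using p D_nonneg by (intro nn_integral_powr_lessThan) auto
  have levels: "zsum (\<lambda>j. ennreal (2 powr j * D j powr (1 / p))) =
     ennreal (2 / p) * zsum (\<lambda>j. ennreal (2 powr j / 2) * (\<integral>\<^sup>+t\<in>{0<..}. ennreal (t powr (1 / p - 1)) * indicator {..<D j} t \<partial>lborel))"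
    unfolding zsum_cmult[symmetric] int using p D_nonneg
    by (intro arg_cong[where f = zsum] ext) (simp add: ennreal_mult[symmetric])
  have "zsum (\<lambda>j. ennreal (2 powr j / 2) * (\<integral>\<^sup>+t\<in>{0<..}. ennreal (t powr (1 / p - 1)) * indicator {..<D j} t \<partial>lborel))
     = (\<integral>\<^sup>+t. zsum (\<lambda>j. ennreal (2 powr j / 2) * (ennreal (t powr (1 / p - 1)) * indicator {..<D j} t * indicator {0<..} t)) \<partial>lborel)"
    by (intro nn_integral_zsum_cmult[symmetric]) measurable
  also have "\<dots> \<le> lorentz_norm p M f"
    unfolding lorentz_norm_def
  proof (intro nn_integral_mono)
    fix t :: real
    show "zsum (\<lambda>j. ennreal (2 powr j / 2) * (ennreal (t powr (1 / p - 1)) * indicator {..<D j} t * indicator {0<..} t))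
      \<le> ennreal (t powr (1 / p - 1)) * rearrangement M f t * indicator {0<..} t"
    proof (cases "0 < t")
      case True
      have "zsum (\<lambda>j. ennreal (2 powr j / 2) * (ennreal (t powr (1 / p - 1)) * indicator {..<D j} t * indicator {0<..} t))
        = ennreal (t powr (1 / p - 1)) * zsum (\<lambda>j. if ennreal t < ennreal (D j) then ennreal (2 powr real_of_int j / 2) else 0)"
        unfolding zsum_cmult[symmetric] using True
        by (intro arg_cong[where f = zsum] ext) (auto simp: indicator_def ennreal_less_iff mult.commute)
      also have "\<dots> \<le> ennreal (t powr (1 / p - 1)) * rearrangement M f t"
        using zsum_dyadic_levels_le_rearrangement[OF fm, of t] unfolding D by (intro mult_left_mono) auto
      finally show ?thesis using True by simp
    qed (auto simp: zsum_def)
  qed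
  finally have "zsum (\<lambda>j. ennreal (2 powr j * D j powr (1 / p))) \<le> ennreal (2 / p) * lorentz_norm p M f"
    unfolding levels by (intro mult_left_mono) auto
  then show ?thesis unfolding D_def .
qed

section \<open>Potentials of functions\<close>

lemma dyadic_bracket:
  fixes u :: real
  assumes "u > 0"
  obtains j :: int where "2 powr j < u" "u \<le> 2 powr real_of_int (j + 1)"
proof
  define j where "j = \<lceil>log 2 u\<rceil> - 1"
  have "real_of_int j < log 2 u" unfolding j_def by linarith
  then show "2 powr j < u" using assms by (simp add: less_log_iff)
  have "log 2 u \<le> real_of_int (j + 1)" unfolding j_def by linarith
  then show "u \<le> 2 powr real_of_int (j + 1)" using assms by (simp add: log_le_iff)
qed

text \<open>A single term of the double sum suffices: with 2^j < |g(y)| \<le> 2^(j+1) and 2^k < |x -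
  y| \<le> 2^(k+1), take the indices j and k + 1. The rounding costs 2 for g and 2^\<gamma> for the
  distance. If g(y) = 0 or x = y, the left side is 0.\<close>

lemma riesz_integrand_le_dyadic:
  fixes g :: "'a::metric_space \<Rightarrow> real"
  assumes "\<gamma> > 0"
  shows "ennreal (\<bar>g y\<bar> / dist x y powr \<gamma>) \<le> ennreal (2 powr (\<gamma> + 1)) *
    zsum (\<lambda>j. ennreal (2 powr real_of_int j) * zsum (\<lambda>k. ennreal (2 powr (- \<gamma> * real_of_int k)) *
      (indicator {y. 2 powr real_of_int j < \<bar>g y\<bar>} y * indicator {y. dist x y \<le> 2 powr real_of_int k} y)))"
    (is "_ \<le> _ * zsum (\<lambda>j. _ * zsum (?F j))")
proof (cases "g y = 0 \<or> dist x y = 0")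
  case True
  then show ?thesis by auto
next
  case False
  then have pos: "\<bar>g y\<bar> > 0" "dist x y > 0" by auto
  obtain j where j: "2 powr real_of_int j < \<bar>g y\<bar>" "\<bar>g y\<bar> \<le> 2 powr real_of_int (j + 1)" by (rule dyadic_bracket[OF pos(1)])
  obtain k where k: "2 powr real_of_int k < dist x y" "dist x y \<le> 2 powr real_of_int (k + 1)" by (rule dyadic_bracket[OF pos(2)])
  have "\<bar>g y\<bar> / dist x y powr \<gamma> \<le> 2 powr (j + 1) / (2 powr k) powr \<gamma>"
    using j k pos assms by (intro frac_le powr_mono2) auto
  also have "\<dots> = 2 powr (\<gamma> + 1) * (2 powr j * 2 powr (- \<gamma> * (k + 1)))"
    unfolding powr_powr powr_diff[symmetric] powr_add[symmetric] by (simp add: algebra_simps)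
  finally have "ennreal (\<bar>g y\<bar> / dist x y powr \<gamma>) \<le> ennreal (2 powr (\<gamma> + 1)) * (ennreal (2 powr j) * ennreal (2 powr (- \<gamma> * (k + 1))))"
    by (simp add: ennreal_mult[symmetric] ennreal_leI)
  also have "ennreal (2 powr (- \<gamma> * (k + 1))) = ?F j (k + 1)" using j k by (simp add: indicator_def)
  also have "ennreal (2 powr j) * ?F j (k + 1) \<le> ennreal (2 powr j) * zsum (?F j)"
    by (intro mult_left_mono zsum_ge_term) auto
  also have "\<dots> \<le> zsum (\<lambda>j. ennreal (2 powr real_of_int j) * zsum (?F j))"
    by (rule zsum_ge_term)
  finally show ?thesis by (simp add: mult_left_mono)
qed

lemma riesz_integral_le_dyadic:
  fixes \<mu> :: "'a::euclidean_space measure" and g :: "'a \<Rightarrow> real"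
  assumes \<gamma>: "\<gamma> > 0" and \<mu>: "sets \<mu> = sets borel"
    and g: "g \<in> borel_measurable borel"
    and fin: "\<And>j :: int. emeasure \<mu> {y. 2 powr j < \<bar>g y\<bar>} < \<infinity>"
  shows "(\<integral>\<^sup>+y. ennreal (\<bar>g y\<bar> / dist x y powr \<gamma>) \<partial>\<mu>) \<le> ennreal (2 powr (\<gamma> + 1)) *
    zsum (\<lambda>j. ennreal (2 powr real_of_int j) * dyadic_potential \<gamma> \<mu> {y. 2 powr real_of_int j < \<bar>g y\<bar>} x)"
proof -
  note [measurable_cong] = \<mu>
  note [measurable] = g
  have E: "{y. 2 powr real_of_int j < \<bar>g y\<bar>} \<in> sets borel" for j by measurable
  have "(\<integral>\<^sup>+y. ennreal (\<bar>g y\<bar> / dist x y powr \<gamma>) \<partial>\<mu>) \<le>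
    (\<integral>\<^sup>+y. ennreal (2 powr (\<gamma> + 1)) *
      zsum (\<lambda>j. ennreal (2 powr real_of_int j) * zsum (\<lambda>k. ennreal (2 powr (- \<gamma> * real_of_int k)) *
      (indicator {y. 2 powr real_of_int j < \<bar>g y\<bar>} y * indicator {y. dist x y \<le> 2 powr real_of_int k} y))) \<partial>\<mu>)"
    by (intro nn_integral_mono riesz_integrand_le_dyadic \<gamma>)
  also have "\<dots> = ennreal (2 powr (\<gamma> + 1)) *
      (\<integral>\<^sup>+y. zsum (\<lambda>j. ennreal (2 powr real_of_int j) * zsum (\<lambda>k. ennreal (2 powr (- \<gamma> * real_of_int k)) *
      (indicator {y. 2 powr real_of_int j < \<bar>g y\<bar>} y * indicator {y. dist x y \<le> 2 powr real_of_int k} y))) \<partial>\<mu>)"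
    by (intro nn_integral_cmult) measurable
  also have "\<dots> = ennreal (2 powr (\<gamma> + 1)) *
      zsum (\<lambda>j. ennreal (2 powr real_of_int j) * (\<integral>\<^sup>+y. zsum (\<lambda>k. ennreal (2 powr (- \<gamma> * real_of_int k)) *
      (indicator {y. 2 powr real_of_int j < \<bar>g y\<bar>} y * indicator {y. dist x y \<le> 2 powr real_of_int k} y)) \<partial>\<mu>))"
    by (subst nn_integral_zsum_cmult) measurable
  also have "\<dots> = ennreal (2 powr (\<gamma> + 1)) *
      zsum (\<lambda>j. ennreal (2 powr real_of_int j) * zsum (\<lambda>k. ennreal (2 powr (- \<gamma> * real_of_int k)) *
      (\<integral>\<^sup>+y. indicator {y. 2 powr real_of_int j < \<bar>g y\<bar>} y * indicator {y. dist x y \<le> 2 powr real_of_int k} y \<partial>\<mu>)))"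
  proof -
    have "(\<integral>\<^sup>+y. zsum (\<lambda>k. ennreal (2 powr (- \<gamma> * real_of_int k)) *
      (indicator {y. 2 powr real_of_int j < \<bar>g y\<bar>} y * indicator {y. dist x y \<le> 2 powr real_of_int k} y)) \<partial>\<mu>)
      = zsum (\<lambda>k. ennreal (2 powr (- \<gamma> * real_of_int k)) *
      (\<integral>\<^sup>+y. indicator {y. 2 powr real_of_int j < \<bar>g y\<bar>} y * indicator {y. dist x y \<le> 2 powr real_of_int k} y \<partial>\<mu>))" for j
      by (intro nn_integral_zsum_cmult) measurable
    then show ?thesis by simp
  qed
  also have "\<dots> = ennreal (2 powr (\<gamma> + 1)) *
    zsum (\<lambda>j. ennreal (2 powr real_of_int j) * dyadic_potential \<gamma> \<mu> {y. 2 powr real_of_int j < \<bar>g y\<bar>} x)"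
    unfolding nn_integral_ball_mass[OF \<mu> fin E, symmetric] dyadic_potential_def
    by (simp add: ennreal_mult)
  finally show ?thesis .
qed

text \<open>The bound for sets is applied to each E_j = {|g| > 2^j} and summed by convexity with
  weights proportional to c_j = 2^j \<mu>(E_j)^(1/p). Finiteness almost everywhere is part of the
  claim because \<open>enn2real\<close> sends \<infinity> to 0.\<close>

lemma trace_inequality_borel:
  fixes \<alpha> d p A B :: real
  assumes "0 < \<alpha>" "\<alpha> < d" "1 < p" "A > 0" "B > 0"
  shows "\<exists>C>0. \<forall>(\<mu> :: 'a::euclidean_space measure) \<nu> (g :: 'a \<Rightarrow> real) L.
    trace_pair A d B (d - \<alpha> * p) \<mu> \<nu> \<longrightarrow> g \<in> borel_measurable borel \<longrightarrow>
    (\<forall>j :: int. emeasure \<mu> {y. 2 powr real_of_int j < \<bar>g y\<bar>} < \<infinity>) \<longrightarrow> 0 \<le> L \<longrightarrow>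
    zsum (\<lambda>j. ennreal (2 powr real_of_int j * measure \<mu> {y. 2 powr real_of_int j < \<bar>g y\<bar>} powr (1 / p))) \<le> ennreal L \<longrightarrow>
    (AE x in \<nu>. (\<integral>\<^sup>+y. ennreal (\<bar>g y\<bar> / dist x y powr (d - \<alpha>)) \<partial>\<mu>) < \<infinity>) \<and>
    (\<integral>\<^sup>+x. ennreal (enn2real (\<integral>\<^sup>+y. ennreal (\<bar>g y\<bar> / dist x y powr (d - \<alpha>)) \<partial>\<mu>) powr p) \<partial>\<nu>) \<le> ennreal (C * L powr p)"
proof -
  obtain C where C: "C > 0" and restricted: "\<forall>(\<mu> :: 'a::euclidean_space measure) \<nu> E.
    trace_pair A d B (d - \<alpha> * p) \<mu> \<nu> \<longrightarrow> E \<in> sets borel \<longrightarrow> emeasure \<mu> E < \<infinity> \<longrightarrow>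
    (\<integral>\<^sup>+x. ennreal (enn2real (dyadic_potential (d - \<alpha>) \<mu> E x) powr p) \<partial>\<nu>) \<le> ennreal (C * measure \<mu> E)"
    using restricted_trace_inequality[OF assms, where 'a = 'a] by blast
  define \<gamma> where "\<gamma> = d - \<alpha>"
  have \<gamma>: "\<gamma> > 0" using assms by (simp add: \<gamma>_def)
  define M where "M = 2 powr (\<gamma> + 1)"
  have M: "M > 0" by (simp add: M_def)
  show ?thesis
  proof (rule exI[of _ "M powr p * C"], intro conjI allI impI)
    show "0 < M powr p * C" using M C by simp
    fix \<mu> \<nu> :: "'a measure" and g :: "'a \<Rightarrow> real" and L :: real
    assume pair: "trace_pair A d B (d - \<alpha> * p) \<mu> \<nu>"
    then have \<mu>: "sets \<mu> = sets borel" and \<nu>: "sets \<nu> = sets borel"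
      and sf: "sigma_finite_measure \<mu>"
      and growth: "\<And>x r. r > 0 \<Longrightarrow> emeasure \<mu> (cball x r) \<le> ennreal (A * r powr d)"
      by (auto simp: trace_pair_def)
    assume g: "g \<in> borel_measurable borel"
      and fin: "\<forall>j :: int. emeasure \<mu> {y. 2 powr real_of_int j < \<bar>g y\<bar>} < \<infinity>"
      and L: "0 \<le> L"
        "zsum (\<lambda>j. ennreal (2 powr real_of_int j * measure \<mu> {y. 2 powr real_of_int j < \<bar>g y\<bar>} powr (1 / p))) \<le> ennreal L"
    note fin = fin[rule_format]
    note [measurable_cong] = \<mu> \<nu>
    note [measurable] = g
    define E where "E j = {y. 2 powr real_of_int j < \<bar>g y\<bar>}" for j
    have E: "E j \<in> sets borel" for j unfolding E_def by measurable
    have Efin: "emeasure \<mu> (E j) < \<infinity>" for j using fin unfolding E_def .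
    define c where "c j = 2 powr real_of_int j * measure \<mu> (E j) powr (1 / p)" for j
    have c_nonneg [simp]: "0 \<le> c j" for j by (simp add: c_def)
    define s where "s = enn2real (zsum (\<lambda>j. ennreal (c j)))"
    have c_L: "zsum (\<lambda>j. ennreal (c j)) \<le> ennreal L"
      using L(2) by (simp only: c_def E_def)
    have s_eq: "zsum (\<lambda>j. ennreal (c j)) = ennreal s"
      unfolding s_def by (rule ennreal_enn2real[symmetric]) (rule le_less_trans[OF c_L ennreal_less_top])
    have s: "0 \<le> s" "s \<le> L"
      unfolding s_def using c_L L(1) by (auto intro: enn2real_leI)
    \<comment> \<open>If s = 0, division by zero makes all weights 0; this is consistent, since then
      all c_j are 0.\<close>
    define w where "w j = c j / s" for j
    have w_nonneg [simp]: "0 \<le> w j" for j using s by (simp add: w_def)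
    have c_le_s: "c j \<le> s" for j
      using zsum_ge_term[of "\<lambda>j. ennreal (c j)" j] s unfolding s_eq by simp
    have w_sum: "zsum (\<lambda>j. ennreal (w j)) \<le> 1"
    proof -
      have "zsum (\<lambda>j. ennreal (w j)) = ennreal (1 / s) * zsum (\<lambda>j. ennreal (c j))"
        unfolding zsum_cmult[symmetric] w_def using s by (simp add: ennreal_mult[symmetric])
      then show ?thesis
        unfolding s_eq using s by (simp add: ennreal_mult[symmetric])
    qed
    define V where "V j x = enn2real (dyadic_potential \<gamma> \<mu> (E j) x)" for j x
    have V: "dyadic_potential \<gamma> \<mu> (E j) x = ennreal (V j x)" for j x
      using dyadic_potential_finite[OF \<mu> Efin E assms(1,2) _ growth] assms unfolding V_def \<gamma>_def by simp
    have V_nonneg [simp]: "0 \<le> V j x" for j x by (simp add: V_def)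
    have [measurable]: "ball_mass \<mu> (E j) k \<in> borel_measurable borel" for j k
      by (rule borel_measurable_ball_mass[OF \<mu> Efin E sf])
    have [measurable]: "V j \<in> borel_measurable borel" for j
      unfolding V_def dyadic_potential_def by measurable
    define h where "h j x = 2 powr real_of_int j * V j x" for j x
    have [measurable]: "h j \<in> borel_measurable borel" for j unfolding h_def by measurable
    have h_nonneg [simp]: "0 \<le> h j x" for j x by (simp add: h_def)
    \<comment> \<open>A zero weight forces c_j = 0, hence \<mu>(E_j) = 0 and a vanishing
      potential.\<close>
    have h_zero: "h j x = 0" if "w j = 0" for j x
    proof -
      have "c j = 0" using that c_le_s[of j] c_nonneg[of j] unfolding w_def by (auto simp del: c_nonneg)
      then have 0: "measure \<mu> (E j) = 0" by (simp add: c_def)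
      have "ball_mass \<mu> (E j) k x = 0" for k
      proof -
        have "measure \<mu> (E j \<inter> cball x (2 powr k)) \<le> measure \<mu> (E j)"
          using Efin[of j] E[of j] \<mu> by (intro measure_mono_fmeasurable) (auto intro: fmeasurableI)
        then show ?thesis using 0 by (simp add: ball_mass_def measure_le_0_iff)
      qed
      then show ?thesis by (simp add: h_def V_def dyadic_potential_def zsum_def)
    qed
    \<comment> \<open>The majorant supplied by convexity: the p-th power of the sum of the h_j(x) is
      at most R(x) wherever R(x) is finite.\<close>
    define R where "R x = zsum (\<lambda>j. ennreal (w j powr (1 - p) * h j x powr p))" for x
    have [measurable]: "R \<in> borel_measurable borel" unfolding R_def by measurable
    have R_int: "(\<integral>\<^sup>+x. R x \<partial>\<nu>) \<le> ennreal (C * L powr p)"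
    proof -
      have "(\<integral>\<^sup>+x. R x \<partial>\<nu>) = zsum (\<lambda>j. ennreal (w j powr (1 - p) * 2 powr (j * p)) * (\<integral>\<^sup>+x. ennreal (V j x powr p) \<partial>\<nu>))"
      proof -
        have "(\<integral>\<^sup>+x. R x \<partial>\<nu>) = (\<integral>\<^sup>+x. zsum (\<lambda>j. ennreal (w j powr (1 - p) * 2 powr (j * p)) * ennreal (V j x powr p)) \<partial>\<nu>)"
          unfolding R_def h_def by (simp add: powr_mult powr_powr ennreal_mult[symmetric] mult.assoc)
        also have "\<dots> = zsum (\<lambda>j. ennreal (w j powr (1 - p) * 2 powr (j * p)) * (\<integral>\<^sup>+x. ennreal (V j x powr p) \<partial>\<nu>))"
          by (intro nn_integral_zsum_cmult) measurable
        finally show ?thesis .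
      qed
      also have "\<dots> \<le> zsum (\<lambda>j. ennreal (w j powr (1 - p) * 2 powr (j * p)) * ennreal (C * measure \<mu> (E j)))"
        unfolding V_def \<gamma>_def
        by (intro zsum_mono mult_left_mono restricted[rule_format] pair E Efin) auto
      also have "\<dots> = zsum (\<lambda>j. ennreal (C * s powr (p - 1)) * ennreal (c j))"
      proof (intro arg_cong[where f = zsum] ext)
        fix j
        \<comment> \<open>The weights are chosen for this identity: it makes the bounds for the E_j
          add up to C s^(p - 1) times the sum of the c_j, that is C s^p.\<close>
        have "w j powr (1 - p) * 2 powr (j * p) * measure \<mu> (E j) = s powr (p - 1) * c j"
        proof (cases "c j = 0")
          case True
          then have "w j = 0" by (simp add: w_def)
          then show ?thesis using True by simp
        next
          case False
          then have cj: "c j > 0" using c_nonneg[of j] by linarith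
          then have sp: "s > 0" using c_le_s[of j] by linarith
          have "c j powr p = 2 powr (j * p) * measure \<mu> (E j)"
            unfolding c_def using assms by (simp add: powr_mult powr_powr)
          then have "w j powr (1 - p) * 2 powr (j * p) * measure \<mu> (E j) = w j powr (1 - p) * c j powr p"
            by simp
          also have "\<dots> = s powr (p - 1) * (c j powr (1 - p) * c j powr p)"
          proof -
            have "s powr (p - 1) * s powr (1 - p) = 1" using sp by (simp add: powr_add[symmetric])
            then show ?thesis unfolding w_def using cj sp by (simp add: powr_divide field_simps)
          qed
          also have "c j powr (1 - p) * c j powr p = c j" using cj by (simp add: powr_add[symmetric])
          finally show ?thesis .
        qed
        then show "ennreal (w j powr (1 - p) * 2 powr (j * p)) * ennreal (C * measure \<mu> (E j)) = ennreal (C * s powr (p - 1)) * ennreal (c j)"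
          using C by (simp add: ennreal_mult[symmetric] mult_ac)
      qed
      also have "\<dots> = ennreal (C * s powr p)"
      proof -
        have "s powr (p - 1) * s = s powr p" using s by (cases "s = 0") (auto simp: powr_diff)
        then show ?thesis
          unfolding zsum_cmult s_eq using s C by (simp add: ennreal_mult[symmetric] mult.assoc)
      qed
      also have "\<dots> \<le> ennreal (C * L powr p)"
        using s C assms by (intro ennreal_leI mult_left_mono powr_mono2) auto
      finally show ?thesis .
    qed
    have R_fin: "AE x in \<nu>. R x < \<infinity>"
    proof -
      have "(\<integral>\<^sup>+x. R x \<partial>\<nu>) \<noteq> \<infinity>" using R_int by (metis ennreal_less_top infinity_ennreal_def leD)
      then have "AE x in \<nu>. R x \<noteq> \<infinity>" by (intro nn_integral_PInf_AE) measurable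
      then show ?thesis by eventually_elim (simp add: less_top)
    qed
    define N where "N x = (\<integral>\<^sup>+y. ennreal (\<bar>g y\<bar> / dist x y powr (d - \<alpha>)) \<partial>\<mu>)" for x
    have main: "N x < \<infinity> \<and> ennreal (enn2real (N x) powr p) \<le> ennreal (M powr p) * R x" if "R x < \<infinity>" for x
    proof -
      define r where "r = enn2real (R x)"
      have r: "0 \<le> r" "R x = ennreal r" using that by (auto simp: r_def)
      have "N x \<le> ennreal M * zsum (\<lambda>j. ennreal (2 powr real_of_int j) * dyadic_potential \<gamma> \<mu> (E j) x)"
        unfolding N_def M_def \<gamma>_def[symmetric] E_def by (rule riesz_integral_le_dyadic[OF \<gamma> \<mu> g fin])
      also have "\<dots> = ennreal M * zsum (\<lambda>j. ennreal (h j x))"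
        unfolding V h_def by (simp add: ennreal_mult)
      also have "zsum (\<lambda>j. ennreal (h j x)) \<le> ennreal (r powr (1 / p))"
        using w_sum h_zero r assms unfolding R_def by (intro zsum_le_powr_mean[of p _ w]) auto
      finally have N_le: "N x \<le> ennreal (M * r powr (1 / p))"
        using M by (simp add: ennreal_mult mult_left_mono)
      then have fin: "N x < \<infinity>" by (metis ennreal_less_top infinity_ennreal_def order_le_less_trans)
      have "enn2real (N x) \<le> M * r powr (1 / p)" using N_le M by (intro enn2real_leI) auto
      then have "enn2real (N x) powr p \<le> (M * r powr (1 / p)) powr p"
        using assms by (intro powr_mono2) auto
      also have "\<dots> = M powr p * r" using M r assms by (simp add: powr_mult powr_powr)
      finally have "ennreal (enn2real (N x) powr p) \<le> ennreal (M powr p) * R x"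
        unfolding r(2) using r(1) by (simp add: ennreal_mult[symmetric] ennreal_leI)
      with fin show ?thesis by simp
    qed
    have "(\<integral>\<^sup>+x. ennreal (enn2real (N x) powr p) \<partial>\<nu>) \<le> (\<integral>\<^sup>+x. ennreal (M powr p) * R x \<partial>\<nu>)"
      using R_fin main by (intro nn_integral_mono_AE) (auto elim: eventually_mono)
    also have "\<dots> = ennreal (M powr p) * (\<integral>\<^sup>+x. R x \<partial>\<nu>)"
      by (intro nn_integral_cmult) measurable
    also have "\<dots> \<le> ennreal (M powr p) * ennreal (C * L powr p)"
      by (intro mult_left_mono R_int) auto
    also have "\<dots> = ennreal (M powr p * C * L powr p)"
      using C by (simp add: ennreal_mult[symmetric] mult.assoc)
    finally show "(\<integral>\<^sup>+x. ennreal (enn2real (\<integral>\<^sup>+y. ennreal (\<bar>g y\<bar> / dist x y powr (d - \<alpha>)) \<partial>\<mu>) powr p) \<partial>\<nu>)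
        \<le> ennreal (M powr p * C * L powr p)"
      unfolding N_def .
    show "AE x in \<nu>. (\<integral>\<^sup>+y. ennreal (\<bar>g y\<bar> / dist x y powr (d - \<alpha>)) \<partial>\<mu>) < \<infinity>"
      using R_fin main unfolding N_def by (auto elim: eventually_mono)
  qed
qed

section \<open>Cubes, Radon measures and the completion\<close>

lemma cball_subset_cube:
  fixes x :: "real ^ 'n::finite"
  shows "cball x r \<subseteq> cube (\<chi> i. x $ i - r) (2 * r)"
proof
  fix y assume "y \<in> cball x r"
  then have "\<bar>x $ i - y $ i\<bar> \<le> r" for i
    using component_le_norm_cart[of "x - y" i] by (simp add: dist_norm)
  then have "x $ i - r \<le> y $ i \<and> y $ i \<le> x $ i + r" for i
    by (simp add: abs_le_iff algebra_simps)
  then show "y \<in> cube (\<chi> i. x $ i - r) (2 * r)"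
    by (simp add: cube_def mem_box_cart add.commute)
qed

lemma cube_measurable: "cube a l \<in> sets borel"
  by (simp add: cube_def)

lemma le_mult_if_divide_le_ennreal:
  fixes a b :: ennreal
  assumes "a / ennreal c \<le> b" "0 < c"
  shows "a \<le> b * ennreal c"
proof -
  have "a = (a / ennreal c) * ennreal c"
    using assms(2) by (simp add: ennreal_divide_times divide_mult_eq)
  also have "\<dots> \<le> b * ennreal c" by (intro mult_right_mono assms(1)) simp
  finally show ?thesis .
qed

lemma growth_sup_cube:
  assumes "growth_sup d \<mu> \<le> ennreal A" "0 \<le> A" "0 < l"
  shows "emeasure \<mu> (cube a l) \<le> ennreal (A * l powr d)"
proof -
  have "emeasure \<mu> (cube a l) / ennreal (l powr d) \<le> growth_sup d \<mu>"
    unfolding growth_sup_def using assms(3) by (intro SUP_upper2[of "(a, l)"]) auto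
  then have "emeasure \<mu> (cube a l) \<le> ennreal A * ennreal (l powr d)"
    using assms by (intro le_mult_if_divide_le_ennreal) auto
  then show ?thesis using assms by (simp add: ennreal_mult)
qed

lemma ratio_sup_cube:
  assumes "ratio_sup s \<mu> \<nu> \<le> ennreal B" "0 \<le> B" "0 < l"
    and "0 < emeasure \<mu> (cube a l)" "emeasure \<mu> (cube a l) < \<infinity>"
  shows "emeasure \<nu> (cube a l) \<le> ennreal (B * measure \<mu> (cube a l) powr s)"
proof -
  have "emeasure \<nu> (cube a l) / ennreal (measure \<mu> (cube a l) powr s) \<le> ratio_sup s \<mu> \<nu>"
    unfolding ratio_sup_def using assms by (intro SUP_upper2[of "(a, l)"]) auto
  \<comment> \<open>The denominator is thus a positive real number and the division can be
    undone.\<close>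
  moreover have "0 < measure \<mu> (cube a l)"
    using assms by (simp add: measure_def enn2real_positive_iff less_top)
  ultimately have "emeasure \<nu> (cube a l) \<le> ennreal B * ennreal (measure \<mu> (cube a l) powr s)"
    using assms by (intro le_mult_if_divide_le_ennreal) auto
  then show ?thesis using assms by (simp add: ennreal_mult)
qed

section \<open>Radon measures and the passage from cubes to balls\<close>

lemma sigma_finite_radon_measure:
  assumes "radon_measure \<mu>"
  shows "sigma_finite_measure \<mu>"
proof
  have sets: "sets \<mu> = sets borel" using assms by (simp add: radon_measure_def)
  show "\<exists>A. countable A \<and> A \<subseteq> sets \<mu> \<and> \<Union> A = space \<mu> \<and> (\<forall>a\<in>A. emeasure \<mu> a \<noteq> \<infinity>)"
  proof (intro exI[of _ "range (\<lambda>n. cball 0 (real n))"] conjI)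
    show "\<Union> (range (\<lambda>n. cball 0 (real n))) = space \<mu>"
      using sets_eq_imp_space_eq[OF sets] real_arch_simple by (auto simp: dist_norm)
    show "\<forall>a\<in>range (\<lambda>n. cball 0 (real n)). emeasure \<mu> a \<noteq> \<infinity>"
    proof clarify
      fix n :: nat
      assume "emeasure \<mu> (cball 0 (real n)) = \<infinity>"
      moreover have "emeasure \<mu> (cball 0 (real n)) < \<infinity>"
        using assms compact_cball[of 0 "real n"] unfolding radon_measure_def by blast
      ultimately show False by simp
    qed
  qed (auto simp: sets)
qed

text \<open>A ball of radius r lies in a cube of side 2r, which costs 2^d in the growth bound. As s
  \<ge> 0, this bound may be inserted into \<mu>(Q)^s, turning the ratio condition into a power of
  r.\<close>

lemma radon_trace_pair:
  fixes \<mu> \<nu> :: "(real ^ 'n::finite) measure"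
  assumes "radon_measure \<mu>" "radon_measure \<nu>"
    and "growth_sup d \<mu> \<le> ennreal A" "ratio_sup s \<mu> \<nu> \<le> ennreal B"
    and "0 < A" "0 < B" "0 \<le> s"
  shows "trace_pair (A * 2 powr d) d (B * (A * 2 powr d) powr s) (d * s) \<mu> \<nu>"
  unfolding trace_pair_def
proof (intro conjI allI impI)
  show \<mu>: "sets \<mu> = sets borel" and \<nu>: "sets \<nu> = sets borel"
    using assms by (auto simp: radon_measure_def)
  show "sigma_finite_measure \<mu>" "sigma_finite_measure \<nu>"
    using assms by (auto intro: sigma_finite_radon_measure)
  fix x :: "real ^ 'n" and r :: real
  assume r: "r > 0"
  define Q where "Q = cube (\<chi> i. x $ i - r) (2 * r)"
  have sub: "cball x r \<subseteq> Q" unfolding Q_def by (rule cball_subset_cube)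
  have Q: "Q \<in> sets borel" unfolding Q_def by (rule cube_measurable)
  have Qmu: "emeasure \<mu> Q \<le> ennreal (A * 2 powr d * r powr d)"
    using growth_sup_cube[OF assms(3), of "2 * r"] r assms by (simp add: Q_def powr_mult mult.assoc)
  have "emeasure \<mu> (cball x r) \<le> emeasure \<mu> Q"
    using sub Q \<mu> by (intro emeasure_mono) auto
  with Qmu show "emeasure \<mu> (cball x r) \<le> ennreal (A * 2 powr d * r powr d)" by order
  assume "emeasure \<mu> (cball x r) > 0"
  then have Qpos: "emeasure \<mu> Q > 0" using \<open>emeasure \<mu> (cball x r) \<le> emeasure \<mu> Q\<close> by order
  have Qfin: "emeasure \<mu> Q < \<infinity>" using le_less_trans[OF Qmu ennreal_less_top] by simp
  have "measure \<mu> Q \<le> A * 2 powr d * r powr d"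
    unfolding measure_def using Qmu assms by (intro enn2real_leI) auto
  then have "measure \<mu> Q powr s \<le> (A * 2 powr d * r powr d) powr s"
    using assms by (intro powr_mono2) auto
  also have "\<dots> = (A * 2 powr d) powr s * r powr (d * s)"
    using assms r by (simp add: powr_mult powr_powr)
  finally have *: "B * measure \<mu> Q powr s \<le> B * (A * 2 powr d) powr s * r powr (d * s)"
    using assms by (simp add: mult.assoc)
  have "emeasure \<nu> (cball x r) \<le> emeasure \<nu> Q"
    using sub Q \<nu> by (intro emeasure_mono) auto
  also have "\<dots> \<le> ennreal (B * measure \<mu> Q powr s)"
    unfolding Q_def using assms r Qpos Qfin unfolding Q_def by (intro ratio_sup_cube) auto
  also have "\<dots> \<le> ennreal (B * (A * 2 powr d) powr s * r powr (d * s))"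
    using * by (rule ennreal_leI)
  finally show "emeasure \<nu> (cball x r) \<le> ennreal (B * (A * 2 powr d) powr s * r powr (d * s))" .
qed

text \<open>A Borel representative g has the same distribution function as f, so the Lorentz norm of
  f controls the level sets of g.\<close>

lemma emeasure_completion_level:
  fixes f g :: "'a::euclidean_space \<Rightarrow> real"
  assumes \<mu>: "sets \<mu> = sets borel" and f: "f \<in> borel_measurable (completion \<mu>)"
    and g: "g \<in> borel_measurable borel" and fg: "AE x in \<mu>. f x = g x"
  shows "emeasure (completion \<mu>) {x \<in> space \<mu>. s < \<bar>f x\<bar>} = emeasure \<mu> {x. s < \<bar>g x\<bar>}"
proof -
  have space: "space \<mu> = UNIV" using sets_eq_imp_space_eq[OF \<mu>] by simp
  have E: "{x. s < \<bar>g x\<bar>} \<in> sets \<mu>" unfolding \<mu> using g by measurable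
  have "emeasure (completion \<mu>) {x \<in> space \<mu>. s < \<bar>f x\<bar>} = emeasure (completion \<mu>) {x. s < \<bar>g x\<bar>}"
  proof (rule emeasure_eq_AE)
    show "AE x in completion \<mu>. x \<in> {x \<in> space \<mu>. s < \<bar>f x\<bar>} \<longleftrightarrow> x \<in> {x. s < \<bar>g x\<bar>}"
      using AE_completion[OF fg] by eventually_elim (simp add: space)
    have "{x \<in> space (completion \<mu>). s < \<bar>f x\<bar>} \<in> sets (completion \<mu>)" using f by measurable
    then show "{x \<in> space \<mu>. s < \<bar>f x\<bar>} \<in> sets (completion \<mu>)" by simp
    show "{x. s < \<bar>g x\<bar>} \<in> sets (completion \<mu>)" using E by (rule sets_completionI_sets)
  qed
  also have "\<dots> = emeasure \<mu> {x. s < \<bar>g x\<bar>}"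
    using E by (simp only: emeasure_completion[OF sets_completionI_sets] main_part)
  finally show ?thesis .
qed

text \<open>Finiteness of the absolute integral for g is integrability of the integrand for f over
  the completion. The Bochner integral then has its true value rather than the default 0.\<close>

lemma riesz_potential_bound:
  fixes f g :: "real ^ 'n::finite \<Rightarrow> real"
  assumes \<mu>: "sets \<mu> = sets borel" and f: "f \<in> borel_measurable (completion \<mu>)"
    and g: "g \<in> borel_measurable borel" and fg: "AE x in \<mu>. f x = g x"
    and fin: "(\<integral>\<^sup>+y. ennreal (\<bar>g y\<bar> / dist x y powr (d - \<alpha>)) \<partial>\<mu>) < \<infinity>" (is "?N < _")
  shows "riesz_defined d \<alpha> \<mu> f x"
    and "\<bar>riesz_potential d \<alpha> \<mu> f x\<bar> \<le> enn2real (\<integral>\<^sup>+y. ennreal (\<bar>g y\<bar> / dist x y powr (d - \<alpha>)) \<partial>\<mu>)"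
proof -
  note [measurable_cong] = \<mu>
  note [measurable] = g
  define k where "k y = riesz_kernel d \<alpha> x y" for y
  have k: "k \<in> borel_measurable \<mu>" unfolding k_def riesz_kernel_def by measurable
  have gk: "(\<lambda>y. g y * k y) \<in> borel_measurable \<mu>" using k by measurable
  have fk: "(\<lambda>y. f y * k y) \<in> borel_measurable (completion \<mu>)"
    using f measurable_completion[OF k] by measurable
  have gk': "(\<lambda>y. g y * k y) \<in> borel_measurable (completion \<mu>)"
    using gk by (rule measurable_completion)
  have ae: "AE y in completion \<mu>. f y * k y = g y * k y"
    using AE_completion[OF fg] by eventually_elim simp
  have norm: "norm (g y * k y) = \<bar>g y\<bar> / dist x y powr (d - \<alpha>)" for y
    by (simp add: k_def riesz_kernel_def dist_norm abs_mult)
  have int: "integrable \<mu> (\<lambda>y. g y * k y)"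
    using gk fin unfolding norm[symmetric] by (rule integrableI_bounded)
  then have "integrable (completion \<mu>) (\<lambda>y. g y * k y)"
    by (simp only: integrable_completion[OF gk])
  then show "riesz_defined d \<alpha> \<mu> f x"
    unfolding riesz_defined_def k_def[symmetric] using integrable_cong_AE[OF fk gk' ae] by simp
  have "riesz_potential d \<alpha> \<mu> f x = (\<integral>y. g y * k y \<partial>completion \<mu>)"
    unfolding riesz_potential_def k_def[symmetric] by (rule integral_cong_AE[OF fk gk' ae])
  also have "\<dots> = (\<integral>y. g y * k y \<partial>\<mu>)" by (rule integral_completion[OF gk])
  finally have "\<bar>riesz_potential d \<alpha> \<mu> f x\<bar> \<le> (\<integral>y. norm (g y * k y) \<partial>\<mu>)"
    using integral_norm_bound[of \<mu> "\<lambda>y. g y * k y"] by simp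
  also have "\<dots> = enn2real ?N"
    unfolding norm[symmetric] using gk by (intro integral_eq_nn_integral) auto
  finally show "\<bar>riesz_potential d \<alpha> \<mu> f x\<bar> \<le> enn2real ?N" .
qed

text \<open>The left side is linear in \<nu>, so the constant is chosen after the bounds
  \<open>A\<close> and \<open>B\<close> on the suprema, but before the measures and f.\<close>

theorem theorem1p2:
  fixes d \<alpha> p :: real and A B :: ennreal
  assumes "0 < d" and "d \<le> real CARD('n)"
    and "0 < \<alpha>" and "\<alpha> < d"
    and "1 < p" and "p < d / \<alpha>"
    and "A < \<infinity>" and "B < \<infinity>"
  shows "\<exists>C::real. C > 0 \<and>
    (\<forall>(\<mu> :: (real ^ 'n::finite) measure) (\<nu> :: (real ^ 'n) measure) (f :: real ^ 'n \<Rightarrow> real).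
      radon_measure \<mu> \<longrightarrow> radon_measure \<nu> \<longrightarrow>
      growth_sup d \<mu> \<le> A \<longrightarrow> ratio_sup (1 - \<alpha> * p / d) \<mu> \<nu> \<le> B \<longrightarrow>
      f \<in> lorentz_space p \<mu> \<longrightarrow>
      (AE x in \<nu>. riesz_defined d \<alpha> \<mu> f x) \<and>
      (\<integral>\<^sup>+ x. ennreal (\<bar>riesz_potential d \<alpha> \<mu> f x\<bar> powr p) \<partial>\<nu>)
        \<le> ennreal (C * enn2real (lorentz_norm p \<mu> f) powr p))"
proof -
  define s where "s = 1 - \<alpha> * p / d"
  have s: "0 \<le> s" "d * s = d - \<alpha> * p"
    using assms(1,3,6) by (auto simp: s_def field_simps)
  \<comment> \<open>Adding 1 makes the real bounds positive even if a supremum is 0.\<close>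
  define A1 where "A1 = enn2real A + 1"
  define B1 where "B1 = enn2real B + 1"
  have pos: "0 < A1" "0 < B1" by (auto simp: A1_def B1_def add_nonneg_pos)
  have AB: "A \<le> ennreal A1" "B \<le> ennreal B1"
    using assms(7,8) by (auto simp: A1_def B1_def ennreal_plus)
  define A2 where "A2 = A1 * 2 powr d"
  define B2 where "B2 = B1 * A2 powr s"
  have pos2: "0 < A2" "0 < B2" using pos by (auto simp: A2_def B2_def)
  obtain C where C: "C > 0" and main: "\<forall>(\<mu> :: (real ^ 'n) measure) \<nu> (g :: real ^ 'n \<Rightarrow> real) L.
    trace_pair A2 d B2 (d - \<alpha> * p) \<mu> \<nu> \<longrightarrow> g \<in> borel_measurable borel \<longrightarrow>
    (\<forall>j :: int. emeasure \<mu> {y. 2 powr real_of_int j < \<bar>g y\<bar>} < \<infinity>) \<longrightarrow> 0 \<le> L \<longrightarrow>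
    zsum (\<lambda>j. ennreal (2 powr real_of_int j * measure \<mu> {y. 2 powr real_of_int j < \<bar>g y\<bar>} powr (1 / p))) \<le> ennreal L \<longrightarrow>
    (AE x in \<nu>. (\<integral>\<^sup>+y. ennreal (\<bar>g y\<bar> / dist x y powr (d - \<alpha>)) \<partial>\<mu>) < \<infinity>) \<and>
    (\<integral>\<^sup>+x. ennreal (enn2real (\<integral>\<^sup>+y. ennreal (\<bar>g y\<bar> / dist x y powr (d - \<alpha>)) \<partial>\<mu>) powr p) \<partial>\<nu>) \<le> ennreal (C * L powr p)"
    using trace_inequality_borel[OF assms(3,4,5) pos2, where 'a = "real ^ 'n"] by blast
  show ?thesis
  \<comment> \<open>The factor (2/p)^p comes from bounding the sum over dyadic levels by 2/p times
    the Lorentz norm.\<close>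
  proof (rule exI[of _ "C * (2 / p) powr p"], intro conjI[of "_ > _"] allI impI)
    show "0 < C * (2 / p) powr p" using C assms(5) by simp
    fix \<mu> \<nu> :: "(real ^ 'n) measure" and f :: "real ^ 'n \<Rightarrow> real"
    assume radon: "radon_measure \<mu>" "radon_measure \<nu>"
      and sup: "growth_sup d \<mu> \<le> A" "ratio_sup (1 - \<alpha> * p / d) \<mu> \<nu> \<le> B"
      and f: "f \<in> lorentz_space p \<mu>"
    have \<mu>: "sets \<mu> = sets borel" using radon by (simp add: radon_measure_def)
    have pair: "trace_pair A2 d B2 (d - \<alpha> * p) \<mu> \<nu>"
      unfolding A2_def B2_def s(2)[symmetric]
      by (intro radon_trace_pair radon pos s(1) order_trans[OF sup(1) AB(1)]
          order_trans[OF sup(2)[folded s_def] AB(2)])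
    have fm: "f \<in> borel_measurable (completion \<mu>)" using f by (simp add: lorentz_space_def)
    \<comment> \<open>f is measurable only for the completion; the dyadic argument runs on a Borel
      function equal to it almost everywhere.\<close>
    obtain g where g: "g \<in> borel_measurable \<mu>" and fg: "AE x in \<mu>. f x = g x"
      using completion_ex_borel_measurable_real[OF fm] by blast
    have gb: "g \<in> borel_measurable borel" using g by (simp only: measurable_cong_sets[OF \<mu> refl])
    have level: "emeasure (completion \<mu>) {x \<in> space \<mu>. u < \<bar>f x\<bar>} = emeasure \<mu> {x. u < \<bar>g x\<bar>}" for u
      by (rule emeasure_completion_level[OF \<mu> fm gb fg])
    define l where "l = enn2real (lorentz_norm p \<mu> f)"
    have l: "lorentz_norm p \<mu> f = ennreal l" "0 \<le> l"
      using f by (auto simp: lorentz_space_def l_def)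
    define N where "N x = (\<integral>\<^sup>+y. ennreal (\<bar>g y\<bar> / dist x y powr (d - \<alpha>)) \<partial>\<mu>)" for x
    have p: "0 < p" using assms(5) by simp
    have "zsum (\<lambda>j. ennreal (2 powr real_of_int j * measure \<mu> {y. 2 powr real_of_int j < \<bar>g y\<bar>} powr (1 / p)))
        \<le> ennreal (2 / p) * ennreal l"
      using zsum_dyadic_levels_le_lorentz_norm[OF f p] unfolding measure_def level l(1) .
    also have "\<dots> = ennreal (2 / p * l)" using p l by (subst ennreal_mult) auto
    finally have sum: "zsum (\<lambda>j. ennreal (2 powr real_of_int j * measure \<mu> {y. 2 powr real_of_int j < \<bar>g y\<bar>} powr (1 / p)))
        \<le> ennreal (2 / p * l)" .
    have fin: "\<forall>j :: int. emeasure \<mu> {y. 2 powr real_of_int j < \<bar>g y\<bar>} < \<infinity>"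
      by (intro allI lorentz_norm_finite_level[OF f p, unfolded level]) simp
    have "(AE x in \<nu>. N x < \<infinity>) \<and> (\<integral>\<^sup>+x. ennreal (enn2real (N x) powr p) \<partial>\<nu>) \<le> ennreal (C * (2 / p * l) powr p)"
      unfolding N_def by (rule main[rule_format, OF pair gb fin[rule_format] _ sum]) (use p l in simp)
    then have N: "AE x in \<nu>. N x < \<infinity>"
      and N_int: "(\<integral>\<^sup>+x. ennreal (enn2real (N x) powr p) \<partial>\<nu>) \<le> ennreal (C * (2 / p * l) powr p)"
      by simp_all
    have bound: "riesz_defined d \<alpha> \<mu> f x" "\<bar>riesz_potential d \<alpha> \<mu> f x\<bar> \<le> enn2real (N x)" if "N x < \<infinity>" for x
      unfolding N_def by (rule riesz_potential_bound[OF \<mu> fm gb fg that[unfolded N_def]])+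
    have "AE x in \<nu>. riesz_defined d \<alpha> \<mu> f x"
      using N by eventually_elim (rule bound)
    moreover have "(\<integral>\<^sup>+x. ennreal (\<bar>riesz_potential d \<alpha> \<mu> f x\<bar> powr p) \<partial>\<nu>)
        \<le> ennreal (C * (2 / p) powr p * enn2real (lorentz_norm p \<mu> f) powr p)"
    proof -
      have "(\<integral>\<^sup>+x. ennreal (\<bar>riesz_potential d \<alpha> \<mu> f x\<bar> powr p) \<partial>\<nu>) \<le> (\<integral>\<^sup>+x. ennreal (enn2real (N x) powr p) \<partial>\<nu>)"
      proof (rule nn_integral_mono_AE)
        show "AE x in \<nu>. ennreal (\<bar>riesz_potential d \<alpha> \<mu> f x\<bar> powr p) \<le> ennreal (enn2real (N x) powr p)"
          using N
        proof eventually_elim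
          fix x assume "N x < \<infinity>"
          then show "ennreal (\<bar>riesz_potential d \<alpha> \<mu> f x\<bar> powr p) \<le> ennreal (enn2real (N x) powr p)"
            using p bound(2) by (intro ennreal_leI powr_mono2) auto
        qed
      qed
      also note N_int
      also have "C * (2 / p * l) powr p = C * (2 / p) powr p * l powr p"
        using p l by (simp only: powr_mult)
      finally show ?thesis unfolding l_def .
    qed
    ultimately show "(AE x in \<nu>. riesz_defined d \<alpha> \<mu> f x) \<and>
      (\<integral>\<^sup>+ x. ennreal (\<bar>riesz_potential d \<alpha> \<mu> f x\<bar> powr p) \<partial>\<nu>)
        \<le> ennreal (C * (2 / p) powr p * enn2real (lorentz_norm p \<mu> f) powr p)" ..
  qed
qed

end
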